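(* Let $\mathbf k\in(\mathbb N\cup\{\infty\})^\ell$ and let $\mathbf I=(\mathbf i_1,\dots,\mathbf i_m)$ be a vector composition. Then \[\nu_{\mathcal Q}^{\mathbf k}(M_{\mathbf I})=\begin{cases}1&\mathbf I=(),\\ 2(-1)^{\mathrm{len}(\mathbf I)+|\mathbf I|}&\text{if }|\mathbf i_m|\text{ is odd and }\Sigma\mathbf I\le\mathbf k,\\ 2(-1)^{\mathrm{len}(\mathbf I)}&\text{if }|\mathbf I|-|\mathbf i_m|\text{ is odd},\ \Sigma\mathbf I-\mathbf i_m\le\mathbf k\text{ and }\Sigma\mathbf I\not\le\mathbf k,\\ 0&\text{otherwise,}\end{cases}\] and $\nu_{\mathcal Q}^{\mathbf k}(F_{\mathbf I})=1$ if $\mathbf I=()$; $\nu_{\mathcal Q}^{\mathbf k}(F_{\mathbf I})=2$ if $\mathbf I=(\mathbf E,\mathbf i)$ where $\mathbf E$ is a (possibly empty) sequence of coordinate vectors $\mathbf e_j$ and $\mathbf i$ is a single column, and one of the following holds: (1) $\Sigma\mathbf I\le\mathbf k$; (2) $|\mathbf E|$ is odd and $\Sigma\mathbf E\le\mathbf k$; (3) $|\mathbf E|$ is even, $|\mathbf i|>1$ and $\Sigma\mathbf E+\mathbf e\le\mathbf k$, where $\mathbf e$ is the unique coordinate vector with $\mathbf i\preccurlyeq(\mathbf e,\mathbf i-\mathbf e)$ (namely $\mathbf e=\mathbf e_c$ with $c$ the smallest index such that the $c$-th entry of $\mathbf i$ is nonzero); and $\nu_{\mathcal Q}^{\mathbf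 k}(F_{\mathbf I})=0$ otherwise.
   Context: Fix $\ell\ge1$; $\mathbf e_0,\dots,\mathbf e_{\ell-1}$ are the coordinate vectors of $\mathbb N^\ell$; $|\mathbf n|=\sum n_i$, coordinatewise order on $(\mathbb N\cup\{\infty\})^\ell$. Vector composition: sequence $\mathbf I=(\mathbf i_1,\dots,\mathbf i_m)$ of nonzero elements of $\mathbb N^\ell$; $\mathrm{len}(\mathbf I)=m$, $\Sigma\mathbf I=\sum\mathbf i_r$, $|\mathbf I|=|\Sigma\mathbf I|$; $\Sigma()=\mathbf 0$. $\mathbf I\preccurlyeq\mathbf J$ means $\mathbf J=\mathbf J_1\cdots\mathbf J_m$ with each $\mathbf J_k$ a vector composition whose columns sum to $\mathbf i_k$ and such that, within each $\mathbf J_k$, every index in the support of a column is $\le$ every index in the support of every later column of $\mathbf J_k$. $\mathrm{QSym}^{(\ell)}$ is the $\mathbb Q$-span of $M_{\mathbf I}=\sum_{j_1<\dots<j_m}\mathbf x_{j_1}^{\mathbf i_1}\cdots\mathbf x_{j_m}^{\mathbf i_m}$ ($M_{()}=1$) in commuting variables $x_j^{(i)}$ ($\mathbf x_j^{\mathbf n}=\prod_i(x_j^{(i)})^{n_i}$), a graded connected Hopf algebra with product of power series, deconcatenation coproduct and antipode $\mathsf S_{\mathcal Q}$; $F_{\mathbf I}=\sum_{\mathbf I\preccurlyeq\mathbf J}M_{\mathbf J}$ (with $F_{()}=1$). $\zeta_{\mathcal Q}(M_{\mathbf I})=1$ if $\mathrm{len}(\mathbf I)\le1$, else $0$; $\bar\zeta_{\mathcal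 Q}(h)=(-1)^{|\mathbf n|}\zeta_{\mathcal Q}(h)$ on degree $\mathbf n$. Define $\zeta_{\mathcal Q}^{\mathbf k}$ to agree with $\bar\zeta_{\mathcal Q}$ on degrees $\mathbf n\le\mathbf k$ and with $\zeta_{\mathcal Q}$ on other degrees, and $\nu_{\mathcal Q}^{\mathbf k}=(\zeta_{\mathcal Q}^{\mathbf k}\circ\mathsf S_{\mathcal Q})\,\zeta_{\mathcal Q}$, the convolution product $m\circ((\zeta_{\mathcal Q}^{\mathbf k}\circ\mathsf S_{\mathcal Q})\otimes\zeta_{\mathcal Q})\circ\Delta$. *)

theory Defs
  imports
    "HOL-Analysis.Finite_Cartesian_Product"
    "HOL-Library.Poly_Mapping"
    "HOL-Library.Extended_Nat"
    "HOL-Library.FuncSet"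
begin

section \<open>Vector compositions\<close>

text \<open>
  The index set of the coordinates is a type \<open>'l\<close> that is finite and linearly ordered; being
  nonempty, it is order isomorphic to \<open>{0, \<dots>, l - 1}\<close> for \<open>l = CARD('l) \<ge> 1\<close>. Vectors in
  \<open>\<nat>\<^sup>l\<close> are elements of \<open>nat ^ 'l\<close>, and \<open>axis j 1\<close> is the \<open>j\<close>-th coordinate vector.
\<close>

type_synonym 'l vcomp = "(nat ^ 'l) list"

definition vabs :: "nat ^ 'l::finite \<Rightarrow> nat" where
  "vabs n = (\<Sum>i\<in>UNIV. n $ i)"

definition coord_vectors :: "(nat ^ 'l::finite) set" where
  "coord_vectors = range (\<lambda>j. axis j 1)"

definition vsupp :: "nat ^ 'l::finite \<Rightarrow> 'l set" where
  "vsupp n = {i. n $ i \<noteq> 0}"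

definition vle :: "nat ^ 'l::finite \<Rightarrow> enat ^ 'l \<Rightarrow> bool" (infix "\<le>\<^sub>v" 50) where
  "n \<le>\<^sub>v k \<longleftrightarrow> (\<chi> i. enat (n $ i)) \<le> k"

definition vcomps :: "('l::finite vcomp) set" where
  "vcomps = {I. 0 \<notin> set I}"

definition vrefines :: "'l::{finite,linorder} vcomp \<Rightarrow> 'l vcomp \<Rightarrow> bool" (infix "\<preceq>\<^sub>v" 50) where
  "I \<preceq>\<^sub>v J \<longleftrightarrow>
     (\<exists>Js. J = concat Js \<and>
        list_all2 (\<lambda>i K. K \<in> vcomps \<and> sum_list K = i \<and>
           sorted_wrt (\<lambda>u v. \<forall>a\<in>vsupp u. \<forall>b\<in>vsupp v. a \<le> b) K) I Js)"

definition head_coord :: "nat ^ 'l::{finite,linorder} \<Rightarrow> nat ^ 'l::{finite,linorder}" where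
  "head_coord i = (THE e. e \<in> coord_vectors \<and> [i] \<preceq>\<^sub>v [e, i - e])"


section \<open>Formal power series over the rationals\<close>

text \<open>
  A power series is its family of coefficients, indexed by an additively written monoid \<open>'m\<close> of
  monomials. The product is meaningful whenever every monomial has finitely many factorizations,
  which is the case for the monoids used below.
\<close>

datatype 'm pseries = PS (pcoeff: "'m \<Rightarrow> rat")

instantiation pseries :: (type) ab_group_add
begin

definition "0 = PS (\<lambda>_. 0)"
definition "f + g = PS (\<lambda>m. pcoeff f m + pcoeff g m)"
definition "f - g = PS (\<lambda>m. pcoeff f m - pcoeff g m)"
definition "- f = PS (\<lambda>m. - pcoeff f m)"

instance
  by standard
    (auto simp: zero_pseries_def plus_pseries_def minus_pseries_def uminus_pseries_def
      intro: pseries.expand)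

end

instantiation pseries :: (zero) one
begin

definition "1 = PS (\<lambda>m. if m = 0 then 1 else 0)"

instance ..

end

instantiation pseries :: (plus) times
begin

definition "f * g = PS (\<lambda>m. \<Sum>(a, b) | a + b = m. pcoeff f a * pcoeff g b)"

instance ..

end

definition ps_scale :: "rat \<Rightarrow> 'm pseries \<Rightarrow> 'm pseries" where
  "ps_scale c f = PS (\<lambda>m. c * pcoeff f m)"

global_interpretation ps: vector_space ps_scale
  by standard
    (auto simp: ps_scale_def plus_pseries_def algebra_simps)


section \<open>Multi-quasisymmetric functions\<close>

text \<open>Monomials in the commuting variables \<open>x\<^sub>j\<^sup>(\<^sup>i\<^sup>)\<close>, indexed by the pairs \<open>(j, i)\<close>.\<close>

type_synonym 'l mono = "(nat \<times> 'l) \<Rightarrow>\<^sub>0 nat"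

definition xmono :: "nat \<Rightarrow> nat ^ 'l::finite \<Rightarrow> 'l mono" where
  "xmono j n = (\<Sum>i\<in>UNIV. Poly_Mapping.single (j, i) (n $ i))"

text \<open>
  The coefficient of a monomial in the infinite sum defining \<open>M\<^sub>I\<close> is the number of
  index sequences \<open>j\<^sub>1 < \<dots> < j\<^sub>m\<close> whose summand is that monomial.
\<close>

definition MQ :: "'l::finite vcomp \<Rightarrow> 'l mono pseries" where
  "MQ I = PS (\<lambda>x. of_nat (card {js. sorted_wrt (<) js \<and> length js = length I \<and>
                                 sum_list (map2 xmono js I) = x}))"

definition FQ :: "'l::{finite,linorder} vcomp \<Rightarrow> 'l mono pseries" where
  "FQ I = (\<Sum>J | I \<preceq>\<^sub>v J. MQ J)"

definition QSym :: "('l::finite mono pseries) set" where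
  "QSym = ps.span (MQ ` vcomps)"

text \<open>
  \<open>lin_ext s X b \<phi>\<close> is the linear map, into a space with scalar multiplication \<open>s\<close>, that sends
  the basis vector \<open>b i\<close> to \<open>\<phi> i\<close> for all \<open>i \<in> X\<close>; it is used on the span of \<open>b ` X\<close> only.
\<close>

definition lin_ext ::
  "(rat \<Rightarrow> 'v \<Rightarrow> 'v) \<Rightarrow> 'i set \<Rightarrow> ('i \<Rightarrow> 'm pseries) \<Rightarrow> ('i \<Rightarrow> 'v) \<Rightarrow> 'm pseries \<Rightarrow> 'v::comm_monoid_add"
  where
  "lin_ext s X b \<phi> f =
     (\<Sum>i | i \<in> X \<and> ps.representation (b ` X) f (b i) \<noteq> 0.
        s (ps.representation (b ` X) f (b i)) (\<phi> i))"


section \<open>The Hopf algebra structure\<close>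

text \<open>
  The tensor product of two spaces of power series is realized in the power series in two
  disjoint sets of variables, \<open>f \<otimes> g\<close> being \<open>f(x) g(y)\<close>. The tensors \<open>M\<^sub>I \<otimes> M\<^sub>J\<close> form a basis
  of the tensor square of \<open>QSym\<close>.
\<close>

definition tensor :: "'m pseries \<Rightarrow> 'n pseries \<Rightarrow> ('m \<times> 'n) pseries" where
  "tensor f g = PS (\<lambda>(a, b). pcoeff f a * pcoeff g b)"

definition comultQ :: "'l::finite mono pseries \<Rightarrow> ('l mono \<times> 'l mono) pseries" where
  "comultQ = lin_ext ps_scale vcomps MQ
     (\<lambda>I. \<Sum>p\<le>length I. tensor (MQ (take p I)) (MQ (drop p I)))"

definition counitQ :: "'l::finite mono pseries \<Rightarrow> rat" where
  "counitQ = lin_ext (*) vcomps MQ (\<lambda>I. if I = [] then 1 else 0)"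

text \<open>
  \<open>mult_tensor s \<phi> \<psi>\<close> is the map \<open>m \<circ> (\<phi> \<otimes> \<psi>)\<close> on the tensor square of \<open>QSym\<close>, where \<open>\<phi>\<close> and \<open>\<psi>\<close>
  are linear maps from \<open>QSym\<close> to an algebra with scalar multiplication \<open>s\<close>.
\<close>

definition mult_tensor ::
  "(rat \<Rightarrow> 'a \<Rightarrow> 'a) \<Rightarrow> ('l::finite mono pseries \<Rightarrow> 'a) \<Rightarrow> ('l mono pseries \<Rightarrow> 'a) \<Rightarrow>
   ('l mono \<times> 'l mono) pseries \<Rightarrow> 'a::{comm_monoid_add,times}" where
  "mult_tensor s \<phi> \<psi> =
     lin_ext s (vcomps \<times> vcomps) (\<lambda>(I, J). tensor (MQ I) (MQ J)) (\<lambda>(I, J). \<phi> (MQ I) * \<psi> (MQ J))"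

definition convQ ::
  "(rat \<Rightarrow> 'a \<Rightarrow> 'a) \<Rightarrow> ('l::finite mono pseries \<Rightarrow> 'a) \<Rightarrow> ('l mono pseries \<Rightarrow> 'a) \<Rightarrow>
   'l mono pseries \<Rightarrow> 'a::{comm_monoid_add,times}" where
  "convQ s \<phi> \<psi> = mult_tensor s \<phi> \<psi> \<circ> comultQ"

definition is_antipodeQ :: "('l::finite mono pseries \<Rightarrow> 'l mono pseries) \<Rightarrow> bool" where
  "is_antipodeQ S \<longleftrightarrow>
     S \<in> QSym \<rightarrow>\<^sub>E QSym \<and>
     (\<forall>f\<in>QSym. \<forall>g\<in>QSym. S (f + g) = S f + S g) \<and>
     (\<forall>c. \<forall>f\<in>QSym. S (ps_scale c f) = ps_scale c (S f)) \<and>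
     (\<forall>f\<in>QSym. convQ ps_scale S id f = ps_scale (counitQ f) 1 \<and>
                convQ ps_scale id S f = ps_scale (counitQ f) 1)"

definition antipodeQ :: "'l::finite mono pseries \<Rightarrow> 'l mono pseries" where
  "antipodeQ = (THE S. is_antipodeQ S)"


section \<open>The characters\<close>

definition mdeg :: "'l::finite mono \<Rightarrow> nat ^ 'l" where
  "mdeg x = (\<chi> i. \<Sum>p\<in>Poly_Mapping.keys x. if snd p = i then Poly_Mapping.lookup x p else 0)"

definition hpart :: "nat ^ 'l::finite \<Rightarrow> 'l mono pseries \<Rightarrow> 'l mono pseries" where
  "hpart n f = PS (\<lambda>x. if mdeg x = n then pcoeff f x else 0)"

definition zetaQ :: "'l::finite mono pseries \<Rightarrow> rat" where
  "zetaQ = lin_ext (*) vcomps MQ (\<lambda>I. if length I \<le> 1 then 1 else 0)"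

definition zetabarQ :: "'l::finite mono pseries \<Rightarrow> rat" where
  "zetabarQ f = (\<Sum>n | hpart n f \<noteq> 0. (-1) ^ vabs n * zetaQ (hpart n f))"

definition zetakQ :: "enat ^ 'l::finite \<Rightarrow> 'l mono pseries \<Rightarrow> rat" where
  "zetakQ k f = (\<Sum>n | hpart n f \<noteq> 0.
     if n \<le>\<^sub>v k then zetabarQ (hpart n f) else zetaQ (hpart n f))"

definition nuQ :: "enat ^ 'l::finite \<Rightarrow> 'l mono pseries \<Rightarrow> rat" where
  "nuQ k = convQ (*) (zetakQ k \<circ> antipodeQ) zetaQ"

end

theory Submission
  imports Defs
begin

text \<open>
  For a vector composition \<open>I\<close> of length \<open>m\<close>, the antipode of \<open>M\<^sub>I\<close> is \<open>(-1)\<^sup>m\<close> times the sum of the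
  monomials over weakly decreasing index words \<open>j\<^sub>1 \<ge> \<dots> \<ge> j\<^sub>m\<close>: the convolution identities reduce to
  a cancellation for each single word, and the left one determines the antipode recursively. This
  series is homogeneous of degree \<open>\<Sigma>I\<close>, and \<open>\<zeta>\<close>, which keeps only the variables of
  index 0 and sets them to 1, sends it to 1. Hence \<open>\<nu>(M\<^sub>I) = (-1)\<^sup>m (s(\<Sigma>I) - s(\<Sigma>I - i\<^sub>m))\<close>, where \<open>s(n)\<close> is \<open>(-1)\<close> to the power
  \<open>|n|\<close> if \<open>n \<le> k\<close> and 1 otherwise. For \<open>F\<^sub>I\<close>, a sign-reversing involution on the refinements of each
  column kills every \<open>I\<close> with a column other than the last that is not a coordinate vector, and leaves
  \<open>(-1)\<close> to the power \<open>|E|\<close> times \<open>s(\<Sigma>E) - s(\<Sigma>E + e)\<close> for \<open>I = (E, i)\<close>.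
\<close>

section \<open>Linear extension along a family with dual coefficients\<close>

lemma pcoeff_simps [simp]:
  "pcoeff 0 m = 0" "pcoeff (f + g) m = pcoeff f m + pcoeff g m"
  "pcoeff (ps_scale c f) m = c * pcoeff f m"
  by (simp_all add: zero_pseries_def plus_pseries_def ps_scale_def)

lemma pcoeff_sum [simp]: "pcoeff (sum f A) m = (\<Sum>a\<in>A. pcoeff (f a) m)"
  by (induction A rule: infinite_finite_induct) auto

lemma pseries_eqI: "(\<And>m. pcoeff f m = pcoeff g m) \<Longrightarrow> f = g"
  by (intro pseries.expand) auto

lemma vector_space_rat: "vector_space ((*) :: rat \<Rightarrow> rat \<Rightarrow> rat)"
  by standard (auto simp: algebra_simps)

text \<open>Reading off the coefficient at \<open>d i\<close> acts as the coordinate functional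
  belonging to \<open>b i\<close>. This makes \<open>lin_ext\<close> a genuine linear extension on
  the span; the monomial functions and their tensors are both instances.\<close>

locale dual_family =
  fixes X :: "'i set" and b :: "'i \<Rightarrow> 'm pseries" and d :: "'i \<Rightarrow> 'm"
  assumes dual: "\<And>i j. i \<in> X \<Longrightarrow> j \<in> X \<Longrightarrow> pcoeff (b i) (d j) = (if i = j then 1 else 0)"
begin

lemma inj_on_family: "inj_on b X"
  by (rule inj_onI) (metis dual zero_neq_one)

lemma independent: "ps.independent (b ` X)"
proof
  assume "ps.dependent (b ` X)"
  then obtain S u v where S: "finite S" "S \<subseteq> b ` X" "v \<in> S" "u v \<noteq> 0"
    and 0: "(\<Sum>w\<in>S. ps_scale (u w) w) = 0"
    unfolding ps.dependent_explicit by blast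
  then obtain i where i: "i \<in> X" "v = b i" by auto
  \<comment> \<open>The coefficient at \<open>d i\<close> isolates the scalar of \<open>v\<close> in
    the vanishing combination.\<close>
  have "0 = pcoeff (\<Sum>w\<in>S. ps_scale (u w) w) (d i)"
    using 0 by simp
  also have "\<dots> = (\<Sum>w\<in>S. if w = v then u v else 0)"
    unfolding pcoeff_sum
  proof (rule sum.cong)
    fix w assume "w \<in> S"
    then obtain j where j: "j \<in> X" "w = b j" using S by auto
    show "pcoeff (ps_scale (u w) w) (d i) = (if w = v then u v else 0)"
      using i j dual[of j i] inj_on_family by (auto simp: inj_on_eq_iff)
  qed simp
  also have "\<dots> = u v" using S by simp
  finally show False using S by simp
qed

lemma lin_ext_family:
  assumes "vector_space s" "i \<in> X"
  shows "lin_ext s X b \<phi> (b i) = \<phi> i"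
proof -
  interpret vector_space s by fact
  have r: "ps.representation (b ` X) (b i) = (\<lambda>v. if v = b i then 1 else 0)"
    using assms independent by (intro ps.representation_basis) auto
  have "{j. j \<in> X \<and> ps.representation (b ` X) (b i) (b j) \<noteq> 0} = {i}"
    using assms inj_on_family by (auto simp: r inj_on_eq_iff)
  then show ?thesis by (simp add: lin_ext_def r)
qed

lemma finite_support: "finite {i \<in> X. ps.representation (b ` X) f (b i) \<noteq> 0}"
proof (rule finite_imageD)
  show "finite (b ` {i \<in> X. ps.representation (b ` X) f (b i) \<noteq> 0})"
    by (rule finite_subset[OF _ ps.finite_representation[of "b ` X" f]]) auto
  show "inj_on b {i \<in> X. ps.representation (b ` X) f (b i) \<noteq> 0}"
    by (rule inj_on_subset[OF inj_on_family]) auto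
qed

text \<open>The defining sum runs over the support of the representation of \<open>f\<close>, which
  varies with \<open>f\<close>; padding it with zero terms gives several series one common index
  set.\<close>

lemma lin_ext_superset:
  assumes "vector_space s" "finite T" "T \<subseteq> X"
    "{i \<in> X. ps.representation (b ` X) f (b i) \<noteq> 0} \<subseteq> T"
  shows "lin_ext s X b \<phi> f = (\<Sum>i\<in>T. s (ps.representation (b ` X) f (b i)) (\<phi> i))"
proof -
  interpret vector_space s by fact
  show ?thesis
    unfolding lin_ext_def using assms by (intro sum.mono_neutral_left) auto
qed

lemma lin_ext_add:
  assumes s: "vector_space s" and f: "f \<in> ps.span (b ` X)" and g: "g \<in> ps.span (b ` X)"
  shows "lin_ext s X b \<phi> (f + g) = lin_ext s X b \<phi> f + lin_ext s X b \<phi> g"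
proof -
  interpret vector_space s by fact
  define R where "R = ps.representation (b ` X)"
  have R: "R (f + g) v = R f v + R g v" for v
    unfolding R_def by (simp add: ps.representation_add independent f g)
  \<comment> \<open>The union also contains the support of \<open>f + g\<close>, because
    representations are additive.\<close>
  define T where "T = {i \<in> X. R f (b i) \<noteq> 0} \<union> {i \<in> X. R g (b i) \<noteq> 0}"
  have T: "finite T" "T \<subseteq> X"
    using finite_support[of f] finite_support[of g] by (auto simp: T_def R_def)
  have e: "lin_ext s X b \<phi> h = (\<Sum>i\<in>T. s (R h (b i)) (\<phi> i))"
    if "h \<in> {f, g, f + g}" for h
    unfolding R_def
    by (rule lin_ext_superset[OF s T]) (use that R in \<open>auto simp: T_def R_def\<close>)
  show ?thesis by (simp add: e R scale_left_distrib sum.distrib)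
qed

lemma lin_ext_scale:
  assumes s: "vector_space s" and f: "f \<in> ps.span (b ` X)"
  shows "lin_ext s X b \<phi> (ps_scale c f) = s c (lin_ext s X b \<phi> f)"
proof -
  interpret vector_space s by fact
  define R where "R = ps.representation (b ` X)"
  have R: "R (ps_scale c f) v = c * R f v" for v
    unfolding R_def by (simp add: ps.representation_scale independent f)
  define T where "T = {i \<in> X. R f (b i) \<noteq> 0}"
  have T: "finite T" "T \<subseteq> X"
    using finite_support[of f] by (auto simp: T_def R_def)
  have e: "lin_ext s X b \<phi> h = (\<Sum>i\<in>T. s (R h (b i)) (\<phi> i))"
    if "h \<in> {f, ps_scale c f}" for h
    unfolding R_def
    by (rule lin_ext_superset[OF s T]) (use that R in \<open>auto simp: T_def R_def\<close>)
  show ?thesis by (simp add: e R scale_sum_right)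
qed

lemma lin_ext_sum:
  assumes s: "vector_space s" and "\<And>a. a \<in> A \<Longrightarrow> f a \<in> ps.span (b ` X)"
  shows "lin_ext s X b \<phi> (sum f A) = (\<Sum>a\<in>A. lin_ext s X b \<phi> (f a))"
  using assms(2)
proof (induction A rule: infinite_finite_induct)
  interpret vector_space s by fact
  \<comment> \<open>The value at 0 settles both the empty sum and the sum over an infinite set,
    which is 0 by default.\<close>
  have "lin_ext s X b \<phi> 0 = 0"
    using lin_ext_scale[OF s ps.span_zero, where c = 0] by simp
  then show "lin_ext s X b \<phi> (sum f {}) = (\<Sum>a\<in>{}. lin_ext s X b \<phi> (f a))"
    and "infinite A \<Longrightarrow> lin_ext s X b \<phi> (sum f A) = (\<Sum>a\<in>A. lin_ext s X b \<phi> (f a))" for A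
    by simp_all
qed (simp add: lin_ext_add[OF s] ps.span_sum)

end


section \<open>Monomials and index words\<close>

lemma lookup_xmono [simp]:
  "Poly_Mapping.lookup (xmono j n) (a, i) = (if a = j then n $ i else 0)"
proof -
  have "Poly_Mapping.lookup (xmono j n) (a, i) = (\<Sum>i'\<in>UNIV. if i' = i then (if a = j then n $ i else 0) else 0)"
    unfolding xmono_def lookup_sum
    by (intro sum.cong) (auto simp: lookup_single when_def)
  then show ?thesis by simp
qed

lemma poly_mapping_pair_eqI:
  "(\<And>a i. Poly_Mapping.lookup x (a, i) = Poly_Mapping.lookup y (a, i)) \<Longrightarrow> x = y"
  by (rule poly_mapping_eqI) auto

lemma xmono_add: "xmono j (m + n) = xmono j m + xmono j n"
  by (rule poly_mapping_pair_eqI) (simp add: lookup_add)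

lemma xmono_zero [simp]: "xmono j 0 = 0"
  by (rule poly_mapping_pair_eqI) simp

section \<open>Index words and their monomials\<close>

definition word_mono :: "nat list \<Rightarrow> 'l::finite vcomp \<Rightarrow> 'l mono" where
  "word_mono js I = sum_list (map2 xmono js I)"

lemma word_mono_simps [simp]:
  "word_mono [] I = 0" "word_mono js [] = 0"
  "word_mono (j # js) (i # I) = xmono j i + word_mono js I"
  by (simp_all add: word_mono_def)

lemma word_mono_append:
  "length js = length I \<Longrightarrow> word_mono (js @ ks) (I @ J) = word_mono js I + word_mono ks J"
  by (simp add: word_mono_def)

lemma word_mono_rev: "length js = length I \<Longrightarrow> word_mono (rev js) (rev I) = word_mono js I"
  by (simp add: word_mono_def zip_rev flip: rev_map)

lemma vcomps_simps [simp]: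
  "[] \<in> vcomps" "i # I \<in> vcomps \<longleftrightarrow> i \<noteq> 0 \<and> I \<in> vcomps"
  "I @ J \<in> vcomps \<longleftrightarrow> I \<in> vcomps \<and> J \<in> vcomps"
  "rev I \<in> vcomps \<longleftrightarrow> I \<in> vcomps"
  by (auto simp: vcomps_def)

lemma vcomps_take_drop [simp]:
  "I \<in> vcomps \<Longrightarrow> take p I \<in> vcomps" "I \<in> vcomps \<Longrightarrow> drop p I \<in> vcomps"
  by (auto simp: vcomps_def dest: in_set_takeD in_set_dropD)

lemma sum_list_vcomp_eq_0: "I \<in> vcomps \<Longrightarrow> sum_list I = 0 \<Longrightarrow> I = []"
  by (cases I) (auto simp: vec_eq_iff)

lemma lookup_word_mono_outside:
  "a \<notin> set js \<Longrightarrow> Poly_Mapping.lookup (word_mono js I) (a, i) = 0"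
proof (induction js arbitrary: I)
  case (Cons j js)
  then show ?case by (cases I) (auto simp: lookup_add)
qed simp

lemma lookup_word_mono_inside:
  assumes "I \<in> vcomps" "length js = length I" "a \<in> set js"
  shows "\<exists>i. Poly_Mapping.lookup (word_mono js I) (a, i) \<noteq> 0"
  using assms(2,1,3)
proof (induction js I rule: list_induct2)
  case (Cons j js v I)
  then show ?case by (cases "a = j") (auto simp: lookup_add vec_eq_iff)
qed simp

text \<open>Nonzero columns make the letters of a word exactly the indices occurring in its
  monomial. The least index is then the first letter, its exponents form the first column, and the
  tails are compared by induction.\<close>

lemma word_mono_inject:
  assumes "I \<in> vcomps" "J \<in> vcomps" "length js = length I" "length ks = length J"
    "sorted_wrt (<) js" "sorted_wrt (<) ks" "word_mono js I = word_mono ks J"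
  shows "js = ks \<and> I = J"
  using assms(3,1,2,4-)
proof (induction js I arbitrary: ks J rule: list_induct2)
  case Nil
  then have "ks = []"
    using lookup_word_mono_inside[of J ks "hd ks"] by (cases ks) auto
  with Nil show ?case by simp
next
  case (Cons a js v I)
  have "ks \<noteq> []"
    using lookup_word_mono_inside[of "v # I" "a # js" a] Cons by (auto simp del: word_mono_simps(3))
  then obtain b ks' w J' where k: "ks = b # ks'" "J = w # J'"
    using Cons.prems by (cases ks; cases J) auto
  have "a \<in> set ks"
  proof (rule ccontr)
    assume "a \<notin> set ks"
    then show False
      using lookup_word_mono_outside[of a ks J] Cons lookup_word_mono_inside[of "v # I" "a # js" a]
      by auto
  qed
  moreover have "b \<in> set (a # js)"
  proof (rule ccontr)
    assume "b \<notin> set (a # js)"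
    then show False
      using lookup_word_mono_outside[of b "a # js" "v # I"] Cons k
        lookup_word_mono_inside[of J ks b]
      by auto
  qed
  \<comment> \<open>Each head occurs in the other word and is the least letter of its own, so the
    heads agree.\<close>
  ultimately have ab: "a = b" using Cons.prems k by (auto dest: less_asym)
  have "a \<notin> set js" "a \<notin> set ks'" using Cons.prems k ab by auto
  \<comment> \<open>The tails avoid \<open>a\<close>, so the exponents at index \<open>a\<close>
    come from the first columns alone.\<close>
  then have "v $ i = w $ i" for i
    using arg_cong[OF Cons.prems(6), of "\<lambda>x. Poly_Mapping.lookup x (a, i)"]
    by (simp add: k ab lookup_add lookup_word_mono_outside)
  then have "v = w" by (simp add: vec_eq_iff)
  then show ?case using Cons.IH[of J' ks'] Cons.prems k ab by auto
qed

text \<open>Nonzero columns force every letter of the word to occur in \<open>x\<close>, leaving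
  finitely many letters; so each \<open>card\<close> in a word series is a true count.\<close>

lemma finite_word_fiber:
  assumes "I \<in> vcomps"
  shows "finite {js. P js \<and> length js = length I \<and> word_mono js I = x}"
proof (rule finite_subset)
  show "{js. P js \<and> length js = length I \<and> word_mono js I = x}
      \<subseteq> {js. set js \<subseteq> fst ` Poly_Mapping.keys x \<and> length js = length I}"
  proof safe
    fix js a assume *: "length js = length I" "a \<in> set js" "x = word_mono js I"
    then obtain i where "Poly_Mapping.lookup (word_mono js I) (a, i) \<noteq> 0"
      using lookup_word_mono_inside assms by blast
    then show "a \<in> fst ` Poly_Mapping.keys (word_mono js I)"
      by (intro image_eqI[of _ _ "(a, i)"]) (auto simp: in_keys_iff)
  qed
  show "finite {js. set js \<subseteq> fst ` Poly_Mapping.keys x \<and> length js = length I}"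
    by (intro finite_lists_length_eq) simp
qed

text \<open>Generating function of the index words satisfying \<open>P\<close>; \<open>M\<^sub>I\<close> is the case of strictly
  increasing words and, up to sign, its antipode that of weakly decreasing ones.\<close>

definition word_series :: "(nat list \<Rightarrow> bool) \<Rightarrow> 'l::finite vcomp \<Rightarrow> 'l mono pseries" where
  "word_series P I =
     PS (\<lambda>x. of_nat (card {js. P js \<and> length js = length I \<and> word_mono js I = x}))"

lemma pcoeff_word_series:
  "pcoeff (word_series P I) x = of_nat (card {js. P js \<and> length js = length I \<and> word_mono js I = x})"
  by (simp add: word_series_def)

lemma MQ_eq_word_series: "MQ I = word_series (sorted_wrt (<)) I"
  by (simp add: MQ_def word_series_def word_mono_def)

text \<open>Variables commute, so reversing word and composition together keeps the monomial. This
  turns strictly decreasing words into strictly increasing ones.\<close>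

lemma word_series_rev: "word_series (\<lambda>js. P (rev js)) (rev I) = word_series P I"
proof (rule pseries_eqI)
  fix x
  have "card {js. P (rev js) \<and> length js = length (rev I) \<and> word_mono js (rev I) = x} =
      card {js. P js \<and> length js = length I \<and> word_mono js I = x}"
  proof (rule bij_betw_same_card[of rev], rule bij_betw_byWitness[where f' = rev])
    show "rev ` {js. P (rev js) \<and> length js = length (rev I) \<and> word_mono js (rev I) = x}
        \<subseteq> {js. P js \<and> length js = length I \<and> word_mono js I = x}"
    proof safe
      fix js :: "nat list" assume "length js = length (rev I)"
      then show "word_mono (rev js) I = word_mono js (rev I)"
        using word_mono_rev[of js "rev I"] by simp
    qed auto
  qed (auto simp: word_mono_rev)
  then show "pcoeff (word_series (\<lambda>js. P (rev js)) (rev I)) x = pcoeff (word_series P I) x"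
    by (simp add: pcoeff_word_series)
qed

section \<open>Products of word series\<close>

lemma finite_factorizations:
  fixes x :: "'a \<Rightarrow>\<^sub>0 nat"
  shows "finite {(a, b). a + b = x}"
proof (rule finite_subset)
  let ?A = "{a. \<exists>b. a + b = x}"
  have "finite (Poly_Mapping.lookup ` ?A)"
  proof (rule finite_subset)
    \<comment> \<open>A left factor is bounded by \<open>x\<close> and vanishes off the keys of
      \<open>x\<close>; members of \<open>PiE\<close> are \<open>undefined\<close> there, hence the
      extension by 0.\<close>
    let ?F = "(\<lambda>f p. if p \<in> Poly_Mapping.keys x then f p else 0) `
      (PiE (Poly_Mapping.keys x) (\<lambda>p. {..Poly_Mapping.lookup x p}))"
    show "Poly_Mapping.lookup ` ?A \<subseteq> ?F"
    proof safe
      fix a b :: "'a \<Rightarrow>\<^sub>0 nat" assume x: "x = a + b"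
      show "Poly_Mapping.lookup a \<in> (\<lambda>f p. if p \<in> Poly_Mapping.keys (a + b) then f p else 0) `
      (PiE (Poly_Mapping.keys (a + b)) (\<lambda>p. {..Poly_Mapping.lookup (a + b) p}))"
        by (intro image_eqI[where x = "restrict (Poly_Mapping.lookup a) (Poly_Mapping.keys (a + b))"])
          (auto simp: lookup_add in_keys_iff)
    qed
    show "finite ?F" by (intro finite_imageI finite_PiE) auto
  qed
  then have A: "finite ?A"
    by (rule finite_imageD) (simp add: inj_on_def poly_mapping_eqI)
  have "{b. \<exists>a. a + b = x} = ?A" by (auto simp: add.commute)
  with A show "finite (?A \<times> {b. \<exists>a. a + b = x})" by simp
qed auto

text \<open>A pair of words whose monomials multiply to \<open>x\<close> is one word for
  \<open>I @ J\<close> cut after \<open>length I\<close> letters. No condition links the two halves,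
  so products need no quasi-shuffle expansion.\<close>

lemma word_series_mult:
  assumes I: "I \<in> vcomps" and J: "J \<in> vcomps"
  shows "word_series P I * word_series Q J =
    word_series (\<lambda>js. P (take (length I) js) \<and> Q (drop (length I) js)) (I @ J)"
proof (rule pseries_eqI)
  fix x
  let ?A = "\<lambda>a. {js. P js \<and> length js = length I \<and> word_mono js I = a}"
  let ?B = "\<lambda>b. {js. Q js \<and> length js = length J \<and> word_mono js J = b}"
  let ?C = "{js. (P (take (length I) js) \<and> Q (drop (length I) js)) \<and>
    length js = length (I @ J) \<and> word_mono js (I @ J) = x}"
  let ?Z = "{(a, b). a + b = x}"
  let ?S = "SIGMA (a, b) : ?Z. ?A a \<times> ?B b"
  have "pcoeff (word_series P I * word_series Q J) x =
      (\<Sum>(a, b)\<in>?Z. of_nat (card (?A a \<times> ?B b)))"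
    by (simp add: times_pseries_def pcoeff_word_series card_cartesian_product)
  also have "\<dots> = of_nat (\<Sum>ab\<in>?Z. card (case ab of (a, b) \<Rightarrow> ?A a \<times> ?B b))"
    by (simp add: case_prod_unfold)
  also have "(\<Sum>ab\<in>?Z. card (case ab of (a, b) \<Rightarrow> ?A a \<times> ?B b)) = card ?S"
    using finite_factorizations[of x] finite_word_fiber[OF I, of P] finite_word_fiber[OF J, of Q]
    by (subst card_SigmaI) auto
  also have "card ?S = card ?C"
  \<comment> \<open>The inverse cuts the word and recomputes the two monomials, which the halves
    determine.\<close>
  proof (rule bij_betw_same_card[of "\<lambda>(_, js, ks). js @ ks"],
      rule bij_betw_byWitness[where f' = "\<lambda>js. let u = take (length I) js; v = drop (length I) js
        in ((word_mono u I, word_mono v J), u, v)"])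
    show "(\<lambda>(_, js, ks). js @ ks) ` ?S \<subseteq> ?C" by (auto simp: word_mono_append)
    have e: "word_mono (take (length I) js) I + word_mono (drop (length I) js) J = word_mono js (I @ J)"
      if "length js = length (I @ J)" for js
      using word_mono_append[of "take (length I) js" I "drop (length I) js" J] that by simp
    show "(\<lambda>js. let u = take (length I) js; v = drop (length I) js
        in ((word_mono u I, word_mono v J), u, v)) ` ?C \<subseteq> ?S"
      by (auto simp: Let_def e)
  qed (auto simp: Let_def)
  finally show "pcoeff (word_series P I * word_series Q J) x =
      pcoeff (word_series (\<lambda>js. P (take (length I) js) \<and> Q (drop (length I) js)) (I @ J)) x"
    by (simp add: pcoeff_word_series)
qed

lemma MQ_Nil: "MQ [] = (1 :: 'l::finite mono pseries)"
proof (rule pseries_eqI)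
  fix b :: "'l mono"
  have "{js::nat list. sorted_wrt (<) js \<and> js = [] \<and> 0 = b} = (if b = 0 then {[]} else {})"
    by auto
  then show "pcoeff (MQ []) b = pcoeff 1 b"
    by (simp add: MQ_eq_word_series pcoeff_word_series one_pseries_def)
qed

lemma mult_MQ_Nil: "f * MQ [] = f" for f :: "'l::finite mono pseries"
proof (rule pseries_eqI)
  fix x :: "'l mono"
  have "pcoeff (f * MQ []) x = (\<Sum>(a, b) | a + b = x. pcoeff f a * (if b = 0 then 1 else 0))"
    by (simp add: times_pseries_def MQ_Nil one_pseries_def)
  also have "\<dots> = (\<Sum>(a, b)\<in>{(x, 0 :: 'l mono)}. pcoeff f a * (if b = 0 then 1 else 0))"
    by (rule sum.mono_neutral_right) (use finite_factorizations[of x] in \<open>auto split: if_splits\<close>)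
  finally show "pcoeff (f * MQ []) x = pcoeff f x" by simp
qed

text \<open>Placing the columns at indices 0, 1, 2, ... gives a monomial that occurs in no monomial
  function other than \<open>MQ I\<close>, and there with coefficient 1.\<close>

definition dual_mono :: "'l::finite vcomp \<Rightarrow> 'l mono" where
  "dual_mono I = word_mono [0..<length I] I"

interpretation MQ: dual_family vcomps "MQ :: 'l::finite vcomp \<Rightarrow> _" dual_mono
proof
  fix I J :: "'l vcomp" assume *: "I \<in> vcomps" "J \<in> vcomps"
  have "{js. sorted_wrt (<) js \<and> length js = length I \<and> word_mono js I = dual_mono J} =
    (if I = J then {[0..<length I]} else {})"
    using word_mono_inject[OF *, of _ "[0..<length J]"] sorted_wrt_upt by (auto simp: dual_mono_def)
  then show "pcoeff (MQ I) (dual_mono J) = (if I = J then 1 else 0)"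
    by (simp add: MQ_eq_word_series pcoeff_word_series)
qed

text \<open>Coefficients of a tensor multiply, so pairs of dual monomials are dual to the
  tensors.\<close>

interpretation tensor_MQ: dual_family "vcomps \<times> vcomps"
  "\<lambda>(I, J). tensor (MQ I) (MQ J) :: ('l::finite mono \<times> 'l mono) pseries"
  "\<lambda>(I, J). (dual_mono I, dual_mono J)"
  by standard (auto simp: tensor_def MQ.dual split: if_splits)


section \<open>Convolution and the antipode\<close>

lemma MQ_in_QSym [simp]: "I \<in> vcomps \<Longrightarrow> MQ I \<in> QSym"
  unfolding QSym_def by (intro ps.span_base) auto

text \<open>Membership in \<open>QSym\<close> is carried along the span induction, because the
  linearity facts are available only there.\<close>

lemma QSym_induct [consumes 1, case_names zero MQ add scale]:
  assumes "f \<in> QSym" "P 0" "\<And>I. I \<in> vcomps \<Longrightarrow> P (MQ I)"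
    and "\<And>f g. f \<in> QSym \<Longrightarrow> g \<in> QSym \<Longrightarrow> P f \<Longrightarrow> P g \<Longrightarrow> P (f + g)"
    and "\<And>c f. f \<in> QSym \<Longrightarrow> P f \<Longrightarrow> P (ps_scale c f)"
  shows "P f"
proof -
  have "f \<in> QSym \<and> P f" using assms(1)[unfolded QSym_def]
  proof (rule ps.span_induct)
    show "ps.subspace {f. f \<in> QSym \<and> P f}"
      using assms unfolding QSym_def
      by (intro ps.subspaceI) (auto intro: ps.span_zero ps.span_add ps.span_scale)
  qed (use assms in auto)
  then show ?thesis ..
qed

lemma QSym_closed [simp]:
  "0 \<in> QSym" "f \<in> QSym \<Longrightarrow> g \<in> QSym \<Longrightarrow> f + g \<in> QSym" "f \<in> QSym \<Longrightarrow> ps_scale c f \<in> QSym"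
  by (auto simp: QSym_def ps.span_zero ps.span_add ps.span_scale)

lemmas lin_ext_MQ_add = MQ.lin_ext_add[folded QSym_def]
  and lin_ext_MQ_scale = MQ.lin_ext_scale[folded QSym_def]
  and lin_ext_MQ_sum = MQ.lin_ext_sum[folded QSym_def]

abbreviation QSym2 :: "('l::finite mono \<times> 'l mono) pseries set" where
  "QSym2 \<equiv> ps.span ((\<lambda>(I, J). tensor (MQ I) (MQ J)) ` (vcomps \<times> vcomps))"

lemma tensor_in_QSym2: "I \<in> vcomps \<Longrightarrow> J \<in> vcomps \<Longrightarrow> tensor (MQ I) (MQ J) \<in> QSym2"
  by (intro ps.span_base) auto

lemmas ps_vector_space = ps.vector_space_axioms

lemma comultQ_MQ:
  "I \<in> vcomps \<Longrightarrow> comultQ (MQ I) = (\<Sum>p\<le>length I. tensor (MQ (take p I)) (MQ (drop p I)))"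
  by (simp add: comultQ_def MQ.lin_ext_family[OF ps_vector_space])

text \<open>Linearity of \<open>mult_tensor\<close> is known on \<open>QSym2\<close>; this
  membership transfers it to \<open>convQ\<close>.\<close>

lemma comultQ_in_QSym2: "f \<in> QSym \<Longrightarrow> comultQ f \<in> QSym2" for f :: "'l::finite mono pseries"
proof (induction f rule: QSym_induct)
  case zero
  have "comultQ (0 :: 'l mono pseries) = 0"
    unfolding comultQ_def using lin_ext_MQ_sum[OF ps_vector_space, of "{}"] by simp
  then show ?case by (simp add: ps.span_zero)
next
  case (MQ I)
  then show ?case by (auto simp: comultQ_MQ intro!: ps.span_sum tensor_in_QSym2)
next
  case (add f g)
  then show ?case
    by (auto simp: comultQ_def lin_ext_MQ_add[OF ps_vector_space] intro!: ps.span_add)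
next
  case (scale c f)
  then show ?case
    by (auto simp: comultQ_def lin_ext_MQ_scale[OF ps_vector_space] intro!: ps.span_scale)
qed

lemma convQ_MQ:
  assumes s: "vector_space s" and I: "I \<in> vcomps"
  shows "convQ s \<phi> \<psi> (MQ I) = (\<Sum>p\<le>length I. \<phi> (MQ (take p I)) * \<psi> (MQ (drop p I)))"
proof -
  have "mult_tensor s \<phi> \<psi> (tensor (MQ J) (MQ K)) = \<phi> (MQ J) * \<psi> (MQ K)"
    if "J \<in> vcomps" "K \<in> vcomps" for J K
    using tensor_MQ.lin_ext_family[OF s, of "(J, K)"] that by (simp add: mult_tensor_def)
  with I show ?thesis
    by (simp add: convQ_def comultQ_MQ mult_tensor_def tensor_MQ.lin_ext_sum[OF s] tensor_in_QSym2)
qed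

lemma convQ_add:
  assumes s: "vector_space s" and "f \<in> QSym" "g \<in> QSym"
  shows "convQ s \<phi> \<psi> (f + g) = convQ s \<phi> \<psi> f + convQ s \<phi> \<psi> g"
  using assms comultQ_in_QSym2[of f] comultQ_in_QSym2[of g]
  by (simp add: convQ_def comultQ_def lin_ext_MQ_add[OF ps_vector_space]
      mult_tensor_def tensor_MQ.lin_ext_add[OF s])

lemma convQ_scale:
  assumes s: "vector_space s" and "f \<in> QSym"
  shows "convQ s \<phi> \<psi> (ps_scale c f) = s c (convQ s \<phi> \<psi> f)"
  using assms comultQ_in_QSym2[of f]
  by (simp add: convQ_def comultQ_def lin_ext_MQ_scale[OF ps_vector_space]
      mult_tensor_def tensor_MQ.lin_ext_scale[OF s])

lemma convQ_sum:
  assumes s: "vector_space s" and "\<And>a. a \<in> A \<Longrightarrow> f a \<in> QSym"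
  shows "convQ s \<phi> \<psi> (sum f A) = (\<Sum>a\<in>A. convQ s \<phi> \<psi> (f a))"
proof -
  interpret vector_space s by fact
  have 0: "convQ s \<phi> \<psi> 0 = 0"
    using convQ_scale[OF s QSym_closed(1), where c = 0] by simp
  have "sum f A \<in> QSym \<and> ?thesis" using assms(2)
    by (induction A rule: infinite_finite_induct) (auto simp: 0 convQ_add[OF s])
  then show ?thesis ..
qed

lemma counitQ_MQ: "I \<in> vcomps \<Longrightarrow> counitQ (MQ I) = (if I = [] then 1 else 0)"
  by (simp add: counitQ_def MQ.lin_ext_family[OF vector_space_rat])

text \<open>The words on the left decrease strictly up to position \<open>length P\<close> and
  weakly from there on. The next step is either strict or repeats the letter, and a repeated letter
  amounts to one letter carrying the column \<open>a + r\<close>.\<close>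

lemma word_series_merge:
  assumes vc: "P @ a # r # R \<in> vcomps"
  shows
  "word_series (\<lambda>js. sorted_wrt (>) (take (Suc (length P)) js) \<and> sorted_wrt (\<ge>) (drop (length P) js))
      (P @ a # r # R) =
   word_series (\<lambda>js. sorted_wrt (>) (take (Suc (Suc (length P))) js) \<and>
      sorted_wrt (\<ge>) (drop (Suc (length P)) js)) (P @ a # r # R) +
   word_series (\<lambda>js. sorted_wrt (>) (take (Suc (length P)) js) \<and> sorted_wrt (\<ge>) (drop (length P) js))
      (P @ (a + r) # R)"
proof (rule pseries_eqI)
  fix x :: "'a mono"
  let ?F = "\<lambda>Q (I :: 'a vcomp). {js. Q js \<and> length js = length I \<and> word_mono js I = x}"
  let ?A = "\<lambda>js. sorted_wrt (>) (take (Suc (length P)) js) \<and> sorted_wrt (\<ge>) (drop (length P) js)"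
  let ?B = "\<lambda>js. sorted_wrt (>) (take (Suc (Suc (length P))) js) \<and>
      sorted_wrt (\<ge>) (drop (Suc (length P)) js)"
  let ?E = "\<lambda>js. ?A js \<and> js ! length P = js ! Suc (length P)"
  have split: "\<exists>us u v vs. js = us @ u # v # vs \<and> length us = length P \<and> length vs = length R"
    if "length js = length (P @ a # r # R)" for js :: "nat list"
  proof -
    have "js = take (length P) js @ js ! length P # js ! Suc (length P) # drop (Suc (Suc (length P))) js"
      using that by (simp add: Cons_nth_drop_Suc)
    then show ?thesis using that
      by (intro exI[of _ "take (length P) js"] exI[of _ "js ! length P"]
          exI[of _ "js ! Suc (length P)"] exI[of _ "drop (Suc (Suc (length P))) js"]) auto
  qed
  have "?A js \<longleftrightarrow> ?B js \<or> ?E js" "\<not> (?B js \<and> ?E js)" if "length js = length (P @ a # r # R)" for js :: "nat list"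
    using split[OF that] by (force simp: sorted_wrt_append nth_append)+
  then have "?F ?A (P @ a # r # R) = ?F ?B (P @ a # r # R) \<union> ?F ?E (P @ a # r # R)"
    "?F ?B (P @ a # r # R) \<inter> ?F ?E (P @ a # r # R) = {}" by blast+
  then have 1: "card (?F ?A (P @ a # r # R)) =
      card (?F ?B (P @ a # r # R)) + card (?F ?E (P @ a # r # R))"
    using finite_word_fiber[OF vc] by (simp add: card_Un_disjoint)
  have "card (?F ?A (P @ (a + r) # R)) = card (?F ?E (P @ a # r # R))"
  \<comment> \<open>One map doubles the letter at position \<open>length P\<close>, the other
    deletes one of the two copies.\<close>
  proof (rule bij_betw_same_card, rule bij_betw_byWitness
      [where f = "\<lambda>js. take (length P) js @ js ! length P # drop (length P) js"
        and f' = "\<lambda>js. take (length P) js @ drop (Suc (length P)) js"])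
    have split': "\<exists>us u vs. js = us @ u # vs \<and> length us = length P \<and> length vs = length R"
      if "length js = length (P @ (a + r) # R)" for js :: "nat list"
    proof -
      have "js = take (length P) js @ js ! length P # drop (Suc (length P)) js"
        using that by (simp add: Cons_nth_drop_Suc)
      then show ?thesis using that
        by (intro exI[of _ "take (length P) js"] exI[of _ "js ! length P"]
            exI[of _ "drop (Suc (length P)) js"]) auto
    qed
    show "(\<lambda>js. take (length P) js @ js ! length P # drop (length P) js) ` ?F ?A (P @ (a + r) # R)
        \<subseteq> ?F ?E (P @ a # r # R)"
    proof (rule image_subsetI)
      fix js assume js: "js \<in> ?F ?A (P @ (a + r) # R)"
      then obtain us u vs where e: "js = us @ u # vs" "length us = length P" "length vs = length R"
        using split' by blast
      with js show "take (length P) js @ js ! length P # drop (length P) js \<in> ?F ?E (P @ a # r # R)"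
        by (auto simp: nth_append word_mono_append xmono_add add_ac)
    qed
    show "(\<lambda>js. take (length P) js @ drop (Suc (length P)) js) ` ?F ?E (P @ a # r # R)
        \<subseteq> ?F ?A (P @ (a + r) # R)"
    proof (rule image_subsetI)
      fix js assume js: "js \<in> ?F ?E (P @ a # r # R)"
      then obtain us u v vs where e: "js = us @ u # v # vs" "length us = length P" "length vs = length R"
        using split by blast
      with js show "take (length P) js @ drop (Suc (length P)) js \<in> ?F ?A (P @ (a + r) # R)"
        by (auto simp: nth_append word_mono_append xmono_add add_ac)
    qed
    show "\<forall>js\<in>?F ?A (P @ (a + r) # R). (\<lambda>js. take (length P) js @ drop (Suc (length P)) js)
        (take (length P) js @ js ! length P # drop (length P) js) = js"
    proof
      fix js assume js: "js \<in> ?F ?A (P @ (a + r) # R)"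
      then obtain us u vs where e: "js = us @ u # vs" "length us = length P"
        using split' by blast
      then show "(\<lambda>js. take (length P) js @ drop (Suc (length P)) js)
        (take (length P) js @ js ! length P # drop (length P) js) = js"
        by (simp add: nth_append)
    qed
    show "\<forall>js\<in>?F ?E (P @ a # r # R). (\<lambda>js. take (length P) js @ js ! length P # drop (length P) js)
        (take (length P) js @ drop (Suc (length P)) js) = js"
    proof
      fix js assume js: "js \<in> ?F ?E (P @ a # r # R)"
      then obtain us u v vs where e: "js = us @ u # v # vs" "length us = length P"
        using split by blast
      with js show "(\<lambda>js. take (length P) js @ js ! length P # drop (length P) js)
        (take (length P) js @ drop (Suc (length P)) js) = js"
        by (simp add: nth_append)
    qed
  qed
  with 1 show "pcoeff (word_series ?A (P @ a # r # R)) x =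
    pcoeff (word_series ?B (P @ a # r # R) + word_series ?A (P @ (a + r) # R)) x"
    by (simp add: pcoeff_word_series)
qed

abbreviation QSym_deg :: "nat ^ 'l::finite \<Rightarrow> 'l mono pseries set" where
  "QSym_deg n \<equiv> ps.span (MQ ` {I \<in> vcomps. sum_list I = n})"

text \<open>By merging, the first column of \<open>R\<close> either joins the strict prefix or is
  fused with \<open>a\<close>; both shorten \<open>R\<close> and keep the total. Once
  \<open>R\<close> is empty all words are strictly decreasing, which is a monomial function of the
  reversed composition.\<close>

lemma word_series_decreasing_in_QSym_deg_aux:
  assumes "P @ a # R \<in> vcomps"
  shows "word_series (\<lambda>js. sorted_wrt (>) (take (Suc (length P)) js) \<and>
      sorted_wrt (\<ge>) (drop (length P) js)) (P @ a # R) \<in> QSym_deg (sum_list (P @ a # R))"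
  using assms
proof (induction R arbitrary: P a)
  case Nil
  have "word_series (\<lambda>js. sorted_wrt (>) (take (Suc (length P)) js) \<and>
      sorted_wrt (\<ge>) (drop (length P) js)) (P @ [a]) = word_series (sorted_wrt (>)) (P @ [a])"
  proof -
    \<comment> \<open>One letter remains after the first \<open>length P\<close> letters, so the
      weak condition is vacuous.\<close>
    have "sorted_wrt (\<ge>) (drop (length P) js)" if "length js = length (P @ [a])" for js :: "nat list"
      using that by (intro sorted_wrt01) simp
    then show ?thesis unfolding word_series_def
      by (intro arg_cong[where f = PS] ext arg_cong[where f = of_nat] arg_cong[where f = card]) auto
  qed
  also have "\<dots> = MQ (rev (P @ [a]))"
    using word_series_rev[of "sorted_wrt (>)" "P @ [a]"] by (simp add: MQ_eq_word_series sorted_wrt_rev)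
  also have "\<dots> \<in> QSym_deg (sum_list (P @ [a]))"
    using Nil by (intro ps.span_base imageI) (auto simp: add.commute)
  finally show ?case .
next
  case (Cons r R)
  have "a + r \<noteq> 0" using Cons.prems by (auto simp: vec_eq_iff)
  then show ?case
    using Cons.IH[of "P @ [a]" r] Cons.IH[of P "a + r"] Cons.prems
    by (subst word_series_merge) (auto intro!: ps.span_add simp: add.assoc)
qed

lemma word_series_decreasing_in_QSym_deg:
  assumes "I \<in> vcomps"
  shows "word_series (sorted_wrt (\<ge>)) I \<in> QSym_deg (sum_list I)"
proof (cases I)
  case Nil
  have "word_series (sorted_wrt (\<ge>)) [] = MQ []"
    by (simp add: MQ_eq_word_series word_series_def cong: conj_cong)
  then show ?thesis unfolding Nil by (auto intro!: ps.span_base)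
next
  case (Cons a R)
  have "word_series (sorted_wrt (\<ge>)) (a # R) =
    word_series (\<lambda>js. sorted_wrt (>) (take (Suc 0) js) \<and> sorted_wrt (\<ge>) js) (a # R)"
  proof -
    \<comment> \<open>Strictness of a single letter is vacuous, so the auxiliary lemma applies with
      \<open>P = []\<close>.\<close>
    have "sorted_wrt (>) (take (Suc 0) js)" for js :: "nat list"
      by (cases js) auto
    then show ?thesis by simp
  qed
  then show ?thesis
    using word_series_decreasing_in_QSym_deg_aux[of "[]" a R] assms Cons by simp
qed

lemma QSym_deg_subset: "QSym_deg n \<subseteq> QSym"
  unfolding QSym_def by (intro ps.span_mono) auto

text \<open>A word splits into an \<open>R\<close>-sorted prefix and a (not \<open>R\<close>)-sorted suffix in exactly two adjacent
  ways or not at all, whence the cancellation.\<close>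

lemma sum_alternating_splits:
  assumes R: "transp R" "transp (\<lambda>a b. \<not> R a b)" and "js \<noteq> []"
  shows "(\<Sum>p\<le>length js. (- 1) ^ p *
    (if sorted_wrt R (take p js) \<and> sorted_wrt (\<lambda>a b. \<not> R a b) (drop p js) then 1 else 0)) = (0::rat)"
  using \<open>js \<noteq> []\<close>
proof (induction js rule: induct_list012)
  case (3 a b l)
  let ?N = "\<lambda>a b. \<not> R a b"
  let ?T = "\<lambda>js p. (- 1) ^ p * (if sorted_wrt R (take p js) \<and> sorted_wrt ?N (drop p js) then 1 else 0 :: rat)"
  have N: "sorted_wrt ?N (a # b # l) \<longleftrightarrow> \<not> R a b \<and> sorted_wrt ?N (b # l)"
    using R(2) by (rule sorted_wrt2)
  \<comment> \<open>A split with both \<open>a\<close> and \<open>b\<close> in the prefix requires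
    \<open>R a b\<close> and is a split of \<open>b # l\<close> with \<open>b\<close> in the prefix,
    with the opposite sign.\<close>
  have *: "?T (a # b # l) (Suc (Suc p)) = - of_bool (R a b) * ?T (b # l) (Suc p)" for p
    using sorted_wrt2[OF R(1), of a b "take p l"] by simp
  have "(\<Sum>p\<le>length (a # b # l). ?T (a # b # l) p) =
    ?T (a # b # l) 0 + (?T (a # b # l) 1 + (\<Sum>p\<le>length l. ?T (a # b # l) (Suc (Suc p))))"
    by (simp only: list.size sum.atMost_Suc_shift add_Suc_right add_0_right One_nat_def)
  also have "(\<Sum>p\<le>length l. ?T (a # b # l) (Suc (Suc p))) =
      - of_bool (R a b) * (\<Sum>p\<le>length l. ?T (b # l) (Suc p))"
    by (simp only: * sum_distrib_left)
  \<comment> \<open>By the induction hypothesis the terms with nonempty prefix cancel the one with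
    empty prefix.\<close>
  also have "(\<Sum>p\<le>length l. ?T (b # l) (Suc p)) = - ?T (b # l) 0"
    using 3(2) by (simp only: list.size sum.atMost_Suc_shift add_Suc_right add_0_right) simp
  also have "?T (a # b # l) 0 + (?T (a # b # l) 1 + - of_bool (R a b) * - ?T (b # l) 0) = 0"
    by (cases "R a b"; cases "sorted_wrt ?N (b # l)")
      (simp_all add: N sorted_wrt1 del: sorted_wrt.simps(2))
  finally show ?case .
qed auto

text \<open>Each product counts words for the whole of \<open>I\<close> subject to a condition
  depending on \<open>p\<close>. Exchanging the sums leaves an alternating sum over the splits of
  one fixed word.\<close>

lemma sum_word_series_splits:
  assumes R: "transp R" "transp (\<lambda>a b. \<not> R a b)" and I: "I \<in> vcomps" "I \<noteq> []"
  shows "(\<Sum>p\<le>length I. ps_scale ((- 1) ^ p)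
    (word_series (sorted_wrt R) (take p I) * word_series (sorted_wrt (\<lambda>a b. \<not> R a b)) (drop p I))) = 0"
proof (rule pseries_eqI)
  fix x
  let ?N = "\<lambda>a b. \<not> R a b"
  let ?Q = "\<lambda>p js. sorted_wrt R (take p js) \<and> sorted_wrt ?N (drop p js)"
  \<comment> \<open>The conjunct \<open>True\<close> makes this an instance of
    \<open>finite_word_fiber\<close>.\<close>
  let ?F = "{js. True \<and> length js = length I \<and> word_mono js I = x}"
  have c: "of_nat (card {js. ?Q p js \<and> length js = length I \<and> word_mono js I = x}) =
    (\<Sum>js\<in>?F. if ?Q p js then 1 else 0 :: rat)" for p
  proof -
    have "{js. ?Q p js \<and> length js = length I \<and> word_mono js I = x} = {js \<in> ?F. ?Q p js}" by auto
    then show ?thesis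
      using finite_word_fiber[OF I(1), of "\<lambda>_. True"]
      by (simp add: sum.If_cases Int_def del: simp_thms) 
  qed
  have "pcoeff (\<Sum>p\<le>length I. ps_scale ((- 1) ^ p)
    (word_series (sorted_wrt R) (take p I) * word_series (sorted_wrt ?N) (drop p I))) x =
    (\<Sum>p\<le>length I. (- 1) ^ p * of_nat (card {js. ?Q p js \<and> length js = length I \<and> word_mono js I = x}))"
    unfolding pcoeff_sum using I
    by (intro sum.cong) (simp_all add: word_series_mult pcoeff_word_series min_absorb2)
  also have "\<dots> = (\<Sum>p\<le>length I. \<Sum>js\<in>?F. (- 1) ^ p * (if ?Q p js then 1 else 0))"
    unfolding c by (simp only: sum_distrib_left)
  also have "\<dots> = (\<Sum>js\<in>?F. \<Sum>p\<le>length I. (- 1) ^ p * (if ?Q p js then 1 else 0))"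
    by (rule sum.swap)
  also have "\<dots> = 0"
  proof (rule sum.neutral, safe)
    fix js :: "nat list" assume "length js = length I"
    then show "(\<Sum>p\<le>length I. (- 1) ^ p * (if ?Q p js then 1 else 0 :: rat)) = 0"
      using sum_alternating_splits[OF R, of js] I by (cases js) auto
  qed
  finally show "pcoeff (\<Sum>p\<le>length I. ps_scale ((- 1) ^ p)
    (word_series (sorted_wrt R) (take p I) * word_series (sorted_wrt ?N) (drop p I))) x = pcoeff 0 x"
    by simp
qed

section \<open>Construction and uniqueness of the antipode\<close>

lemma ps_scale_mult:
  "ps_scale c f * g = ps_scale c (f * g)" "f * ps_scale c g = ps_scale c (f * g)"
  by (auto intro!: pseries_eqI simp: times_pseries_def sum_distrib_left case_prod_unfold mult_ac)

definition antipode_MQ :: "'l::finite vcomp \<Rightarrow> 'l mono pseries" where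
  "antipode_MQ I = ps_scale ((- 1) ^ length I) (word_series (sorted_wrt (\<ge>)) I)"

lemma antipode_MQ_in_QSym: "I \<in> vcomps \<Longrightarrow> antipode_MQ I \<in> QSym"
  unfolding antipode_MQ_def
  by (intro QSym_closed subsetD[OF QSym_deg_subset, of _ "sum_list I"]
      word_series_decreasing_in_QSym_deg)

lemma antipode_MQ_Nil: "antipode_MQ [] = MQ []"
  by (simp add: antipode_MQ_def MQ_eq_word_series word_series_def cong: conj_cong)

text \<open>The relations \<open>(<)\<close> and \<open>(\<ge>)\<close> on indices are negations of
  each other, so both identities are instances of the split cancellation: prefixes are weakly
  decreasing in the first and strictly increasing in the second.\<close>

lemma convolution_antipode_MQ:
  assumes I: "I \<in> vcomps"
  shows "(\<Sum>p\<le>length I. antipode_MQ (take p I) * MQ (drop p I)) = ps_scale (if I = [] then 1 else 0) 1"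
    and "(\<Sum>p\<le>length I. MQ (take p I) * antipode_MQ (drop p I)) = ps_scale (if I = [] then 1 else 0) 1"
proof -
  have n: "(\<lambda>a b::nat. \<not> b \<le> a) = (<)" "(\<lambda>a b::nat. \<not> a < b) = (\<ge>)" by (auto simp: fun_eq_iff)
  have t: "transp ((<) :: nat \<Rightarrow> _)" "transp ((\<ge>) :: nat \<Rightarrow> _)" by (auto intro!: transpI)
  have "(\<Sum>p\<le>length I. antipode_MQ (take p I) * MQ (drop p I)) =
    (\<Sum>p\<le>length I. ps_scale ((- 1) ^ p)
      (word_series (sorted_wrt (\<ge>)) (take p I) * word_series (sorted_wrt (<)) (drop p I)))"
    by (intro sum.cong) (simp_all add: antipode_MQ_def MQ_eq_word_series ps_scale_mult min_absorb2)
  also have "\<dots> = 0" if "I \<noteq> []"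
    using sum_word_series_splits[of "(\<ge>)" I] that I t by (simp add: n)
  finally show "(\<Sum>p\<le>length I. antipode_MQ (take p I) * MQ (drop p I)) =
      ps_scale (if I = [] then 1 else 0) 1"
    by (cases "I = []") (auto simp: antipode_MQ_Nil MQ_Nil mult_MQ_Nil[unfolded MQ_Nil])
  have "(\<Sum>p\<le>length I. MQ (take p I) * antipode_MQ (drop p I)) =
    (\<Sum>p\<le>length I. ps_scale ((- 1) ^ length I) (ps_scale ((- 1) ^ p)
      (word_series (sorted_wrt (<)) (take p I) * word_series (sorted_wrt (\<ge>)) (drop p I))))"
  proof (rule sum.cong)
    fix p assume "p \<in> {..length I}"
    \<comment> \<open>The antipode acts on the suffix here; pulling out the sign of the full length
      leaves the sign of the prefix.\<close>
    then have "(- 1) ^ length I * (- 1) ^ p = ((- 1) ^ (length I - p) :: rat)"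
      by (simp add: minus_one_power_iff)
    then show "MQ (take p I) * antipode_MQ (drop p I) = ps_scale ((- 1) ^ length I) (ps_scale ((- 1) ^ p)
      (word_series (sorted_wrt (<)) (take p I) * word_series (sorted_wrt (\<ge>)) (drop p I)))"
      by (simp add: antipode_MQ_def MQ_eq_word_series ps_scale_mult)
  qed simp
  also have "\<dots> = 0" if "I \<noteq> []"
    using sum_word_series_splits[of "(<)" I] that I t
    by (subst ps.scale_sum_right[symmetric]) (simp add: n)
  finally show "(\<Sum>p\<le>length I. MQ (take p I) * antipode_MQ (drop p I)) =
      ps_scale (if I = [] then 1 else 0) 1"
    by (cases "I = []") (auto simp: antipode_MQ_Nil MQ_Nil mult_MQ_Nil[unfolded MQ_Nil])
qed

text \<open>The restriction makes the map extensional, as \<open>is_antipodeQ\<close> demands; this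
  is what makes the antipode unique as a total function.\<close>

definition antipode_candidate :: "'l::finite mono pseries \<Rightarrow> 'l mono pseries" where
  "antipode_candidate = restrict (lin_ext ps_scale vcomps MQ antipode_MQ) QSym"

lemma antipode_candidate_MQ: "I \<in> vcomps \<Longrightarrow> antipode_candidate (MQ I) = antipode_MQ I"
  by (simp add: antipode_candidate_def MQ.lin_ext_family[OF ps_vector_space])

lemma antipode_candidate_linear:
  "f \<in> QSym \<Longrightarrow> g \<in> QSym \<Longrightarrow>
    antipode_candidate (f + g) = antipode_candidate f + antipode_candidate g"
  "f \<in> QSym \<Longrightarrow> antipode_candidate (ps_scale c f) = ps_scale c (antipode_candidate f)"
  by (simp_all add: antipode_candidate_def lin_ext_MQ_add[OF ps_vector_space]
      lin_ext_MQ_scale[OF ps_vector_space])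

lemma is_antipodeQ_candidate: "is_antipodeQ (antipode_candidate :: 'l::finite mono pseries \<Rightarrow> _)"
  unfolding is_antipodeQ_def
proof (intro conjI ballI allI)
  have 0: "antipode_candidate 0 = (0 :: 'l mono pseries)"
    using antipode_candidate_linear(2)[of 0 0] by simp
  have "antipode_candidate f \<in> QSym" if "f \<in> QSym" for f :: "'l mono pseries"
    using that
    by (induction rule: QSym_induct)
      (auto simp: antipode_candidate_MQ antipode_MQ_in_QSym antipode_candidate_linear 0)
  then show "antipode_candidate \<in> QSym \<rightarrow>\<^sub>E (QSym :: 'l mono pseries set)"
    by (auto simp: antipode_candidate_def)
next
  fix f :: "'l mono pseries" assume f: "f \<in> QSym"
  note l = convQ_add[OF ps_vector_space] convQ_scale[OF ps_vector_space] convQ_MQ[OF ps_vector_space]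
  have counit_lin: "f \<in> QSym \<Longrightarrow> g \<in> QSym \<Longrightarrow> counitQ (f + g) = counitQ f + counitQ g"
    "f \<in> QSym \<Longrightarrow> counitQ (ps_scale c f) = c * counitQ f" for f g :: "'l mono pseries" and c
    by (simp_all add: counitQ_def lin_ext_MQ_add[OF vector_space_rat]
        lin_ext_MQ_scale[OF vector_space_rat])
  have 0: "convQ ps_scale \<phi> \<psi> 0 = 0" for \<phi> \<psi> :: "'l mono pseries \<Rightarrow> 'l mono pseries"
    using convQ_scale[OF ps_vector_space QSym_closed(1), where c = 0] by simp
  have counit0: "counitQ (0 :: 'l mono pseries) = 0"
    using counit_lin(2)[of 0 0] by simp
  show "convQ ps_scale antipode_candidate id f = ps_scale (counitQ f) 1"
    using f
    by (induction rule: QSym_induct)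
      (simp_all add: l 0 counit0 counit_lin counitQ_MQ antipode_candidate_MQ convolution_antipode_MQ
        ps.scale_left_distrib)
  show "convQ ps_scale id antipode_candidate f = ps_scale (counitQ f) 1"
    using f
    by (induction rule: QSym_induct)
      (simp_all add: l 0 counit0 counit_lin counitQ_MQ antipode_candidate_MQ convolution_antipode_MQ
        ps.scale_left_distrib)
qed (simp_all add: antipode_candidate_linear)

text \<open>The last summand of the left convolution identity is \<open>S (M\<^sub>I) * 1\<close>, so that identity alone
  determines \<open>S\<close> by recursion on the length.\<close>

lemma is_antipodeQ_MQ:
  assumes S: "is_antipodeQ S" and "I \<in> vcomps"
  shows "S (MQ I) = antipode_MQ I"
  using assms(2)
proof (induction "length I" arbitrary: I rule: less_induct)
  case less
  let ?c = "ps_scale (if I = [] then 1 else 0 :: rat) (1 :: 'a mono pseries)"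
  have "convQ ps_scale S id (MQ I) = ?c"
    using S less.prems by (auto simp: is_antipodeQ_def counitQ_MQ)
  then have "(\<Sum>p\<le>length I. S (MQ (take p I)) * MQ (drop p I)) = ?c"
    using less.prems by (simp add: convQ_MQ[OF ps_vector_space])
  then have "(\<Sum>p<length I. S (MQ (take p I)) * MQ (drop p I)) + S (MQ I) = ?c"
    by (simp add: mult_MQ_Nil flip: lessThan_Suc_atMost)
  moreover have "S (MQ (take p I)) = antipode_MQ (take p I)" if "p < length I" for p
    using that less.prems by (intro less.hyps) auto
  then have "(\<Sum>p<length I. S (MQ (take p I)) * MQ (drop p I)) =
      (\<Sum>p<length I. antipode_MQ (take p I) * MQ (drop p I))"
    by (intro sum.cong) simp_all
  moreover have "(\<Sum>p<length I. antipode_MQ (take p I) * MQ (drop p I)) + antipode_MQ I = ?c"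
    using convolution_antipode_MQ(1)[OF less.prems] by (simp add: mult_MQ_Nil flip: lessThan_Suc_atMost)
  ultimately have "(\<Sum>p<length I. antipode_MQ (take p I) * MQ (drop p I)) + S (MQ I) =
      (\<Sum>p<length I. antipode_MQ (take p I) * MQ (drop p I)) + antipode_MQ I"
    by (simp only:)
  then show ?case by (rule add_left_imp_eq)
qed

text \<open>Two antipodes agree on the monomial functions, hence by linearity on
  \<open>QSym\<close>, and are both \<open>undefined\<close> outside it.\<close>

lemma antipodeQ_eq: "antipodeQ = antipode_candidate"
  unfolding antipodeQ_def
proof (rule the_equality, rule is_antipodeQ_candidate)
  fix S :: "'a mono pseries \<Rightarrow> 'a mono pseries" assume S: "is_antipodeQ S"
  have add: "S (f + g) = S f + S g" if "f \<in> QSym" "g \<in> QSym" for f g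
    using S that by (simp add: is_antipodeQ_def)
  have scale: "S (ps_scale c f) = ps_scale c (S f)" if "f \<in> QSym" for c f
    using S that by (simp add: is_antipodeQ_def)
  show "S = antipode_candidate"
  proof
    fix f
    show "S f = antipode_candidate f"
    proof (cases "f \<in> QSym")
      case True
      then show ?thesis
      proof (induction rule: QSym_induct)
        case zero
        show ?case using scale[of 0 0] antipode_candidate_linear(2)[of 0 0] by simp
      qed (simp_all add: is_antipodeQ_MQ[OF S] antipode_candidate_MQ antipode_candidate_linear add scale)
    next
      case False
      then show ?thesis using S
        by (auto simp: is_antipodeQ_def antipode_candidate_def PiE_def extensional_def)
    qed
  qed
qed

lemma antipodeQ_MQ: "I \<in> vcomps \<Longrightarrow> antipodeQ (MQ I) = antipode_MQ I"
  by (simp add: antipodeQ_eq antipode_candidate_MQ)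


section \<open>The characters on monomial functions\<close>

lemma mdeg_superset:
  assumes "finite A" "Poly_Mapping.keys x \<subseteq> A"
  shows "mdeg x $ i = (\<Sum>p\<in>A. if snd p = i then Poly_Mapping.lookup x p else 0)"
  unfolding mdeg_def using assms
  by (auto intro!: sum.mono_neutral_left simp: in_keys_iff)

lemma mdeg_add: "mdeg (x + y) = mdeg x + mdeg y"
proof -
  have "mdeg (x + y) $ i = mdeg x $ i + mdeg y $ i" for i
  proof -
    let ?A = "Poly_Mapping.keys x \<union> Poly_Mapping.keys y"
    have "Poly_Mapping.keys (x + y) \<subseteq> ?A" by (rule Poly_Mapping.keys_add)
    then show ?thesis
      by (subst (1 2 3) mdeg_superset[of ?A])
        (auto simp: lookup_add sum.distrib[symmetric] intro!: sum.cong)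
  qed
  then show ?thesis by (simp add: vec_eq_iff)
qed

lemma mdeg_zero [simp]: "mdeg 0 = 0"
  by (simp add: mdeg_def vec_eq_iff)

lemma mdeg_xmono [simp]: "mdeg (xmono j n) = n"
proof -
  have "mdeg (xmono j n) $ i = n $ i" for i
  proof -
    have "mdeg (xmono j n) $ i =
        (\<Sum>p\<in>Pair j ` UNIV. if snd p = i then Poly_Mapping.lookup (xmono j n) p else 0)"
      by (rule mdeg_superset) (auto simp: in_keys_iff split: if_splits)
    then show ?thesis by (simp add: sum.reindex inj_on_def)
  qed
  then show ?thesis by (simp add: vec_eq_iff)
qed

lemma mdeg_word_mono: "length js = length I \<Longrightarrow> mdeg (word_mono js I) = sum_list I"
  by (induction js I rule: list_induct2) (simp_all add: mdeg_add)

lemma QSym_deg_induct [consumes 1, case_names zero MQ add scale]: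
  assumes "f \<in> QSym_deg n" "P 0" "\<And>I. I \<in> vcomps \<Longrightarrow> sum_list I = n \<Longrightarrow> P (MQ I)"
    and "\<And>f g. f \<in> QSym \<Longrightarrow> g \<in> QSym \<Longrightarrow> P f \<Longrightarrow> P g \<Longrightarrow> P (f + g)"
    and "\<And>c f. f \<in> QSym \<Longrightarrow> P f \<Longrightarrow> P (ps_scale c f)"
  shows "P f"
proof -
  have "f \<in> QSym \<and> P f" using assms(1)
  proof (rule ps.span_induct)
    show "ps.subspace {f. f \<in> QSym \<and> P f}"
      using assms by (intro ps.subspaceI) auto
  qed (use assms in auto)
  then show ?thesis ..
qed

lemma pcoeff_QSym_deg:
  assumes "f \<in> QSym_deg n" "mdeg x \<noteq> n"
  shows "pcoeff f x = 0"
  using assms(1)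
proof (induction rule: QSym_deg_induct)
  case (MQ I)
  then have "{js. sorted_wrt (<) js \<and> length js = length I \<and> word_mono js I = x} = {}"
    using assms(2) by (auto simp: mdeg_word_mono)
  then show ?case by (simp only: MQ_eq_word_series pcoeff_word_series) simp
qed auto

lemma hpart_QSym_deg:
  assumes "f \<in> QSym_deg n"
  shows "hpart n' f = (if n' = n then f else 0)"
  using pcoeff_QSym_deg[OF assms] by (auto intro!: pseries_eqI simp: hpart_def)

section \<open>The character zeta and its sign-twisted versions\<close>

lemma zetaQ_linear:
  "f \<in> QSym \<Longrightarrow> g \<in> QSym \<Longrightarrow> zetaQ (f + g) = zetaQ f + zetaQ g"
  "f \<in> QSym \<Longrightarrow> zetaQ (ps_scale c f) = c * zetaQ f"
  by (simp_all add: zetaQ_def lin_ext_MQ_add[OF vector_space_rat]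
      lin_ext_MQ_scale[OF vector_space_rat])

lemma zetaQ_zero: "zetaQ 0 = 0"
  using zetaQ_linear(2)[of 0 0] by simp

lemma zetaQ_MQ: "I \<in> vcomps \<Longrightarrow> zetaQ (MQ I) = (if length I \<le> 1 then 1 else 0)"
  by (simp add: zetaQ_def MQ.lin_ext_family[OF vector_space_rat])

text \<open>The power of the index-0 variables is the dual monomial of the composition with at most
  one column and the same sum, so its coefficient tests whether \<open>I\<close> is that
  composition.\<close>

lemma pcoeff_MQ_xmono:
  assumes I: "I \<in> vcomps"
  shows "pcoeff (MQ I) (xmono 0 (sum_list I)) = (if length I \<le> 1 then 1 else 0)"
proof -
  \<comment> \<open>The empty case is separate because \<open>[0]\<close> is not a vector
    composition.\<close>
  define K where "K = (if I = [] then [] else [sum_list I])"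
  have "sum_list I \<noteq> 0 \<or> I = []" using I sum_list_vcomp_eq_0 by blast
  then have "K \<in> vcomps" "dual_mono K = xmono 0 (sum_list I)"
    by (auto simp: K_def dual_mono_def)
  moreover have "I = K \<longleftrightarrow> length I \<le> 1"
    by (cases I; cases "tl I") (auto simp: K_def)
  ultimately show ?thesis using MQ.dual[OF I, of K] by simp
qed

text \<open>\<open>\<zeta>\<close> sets the variables \<open>x\<^sub>0\<^sup>(\<^sup>i\<^sup>)\<close> to 1 and all others to 0.\<close>

lemma zetaQ_QSym_deg:
  assumes "f \<in> QSym_deg n"
  shows "zetaQ f = pcoeff f (xmono 0 n)"
  using assms
proof (induction rule: QSym_deg_induct)
  case (MQ I)
  then show ?case using pcoeff_MQ_xmono[of I] by (simp add: zetaQ_MQ)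
qed (auto simp: zetaQ_linear zetaQ_zero)

text \<open>The factor by which \<open>zetakQ k\<close> differs from \<open>zetaQ\<close> in degree
  \<open>n\<close>.\<close>

definition ksign :: "enat ^ 'l::finite \<Rightarrow> nat ^ 'l \<Rightarrow> rat" where
  "ksign k n = (if n \<le>\<^sub>v k then (- 1) ^ vabs n else 1)"

lemma zetakQ_QSym_deg:
  assumes "f \<in> QSym_deg n"
  shows "zetakQ k f = ksign k n * zetaQ f"
\<comment> \<open>The sum over degrees is empty for \<open>f = 0\<close> and otherwise has the
  single index \<open>n\<close>.\<close>
proof (cases "f = 0")
  case True
  then show ?thesis using hpart_QSym_deg[OF assms] by (simp add: zetakQ_def zetaQ_zero)
next
  case False
  then have "{n'. hpart n' f \<noteq> 0} = {n}" "hpart n f = f"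
    using hpart_QSym_deg[OF assms] by auto
  then show ?thesis by (simp add: zetakQ_def zetabarQ_def ksign_def)
qed

text \<open>Here zeta reads the coefficient of a power of the index-0 variables. Only the constant
  word of zeros produces it, and that word is weakly decreasing.\<close>

lemma zetaQ_word_series_decreasing:
  assumes I: "I \<in> vcomps"
  shows "zetaQ (word_series (sorted_wrt (\<ge>)) I) = 1"
proof -
  have "{js. sorted_wrt (\<ge>) js \<and> length js = length I \<and> word_mono js I = xmono 0 (sum_list I)} =
    {replicate (length I) 0}"
  proof (intro set_eqI iffI)
    fix js assume *: "js \<in> {js. sorted_wrt (\<ge>) js \<and> length js = length I \<and>
      word_mono js I = xmono 0 (sum_list I)}"
    have "a = 0" if "a \<in> set js" for a
      using lookup_word_mono_inside[of I js a] I that * by (auto split: if_splits)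
    then show "js \<in> {replicate (length I) 0}"
      using * by (auto intro!: replicate_eqI)
  next
    have "word_mono (replicate (length I) 0) I = xmono 0 (sum_list I)"
      by (induction I) (auto simp: xmono_add)
    moreover have "sorted_wrt (\<ge>) (replicate n (0::nat))" for n by (induction n) auto
    ultimately show "js \<in> {js. sorted_wrt (\<ge>) js \<and> length js = length I \<and>
      word_mono js I = xmono 0 (sum_list I)}" if "js \<in> {replicate (length I) 0}" for js
      using that by auto
  qed
  then have "pcoeff (word_series (sorted_wrt (\<ge>)) I) (xmono 0 (sum_list I)) = 1"
    by (simp add: pcoeff_word_series)
  then show ?thesis
    using zetaQ_QSym_deg[OF word_series_decreasing_in_QSym_deg[OF I]] by simp
qed

lemma zetakQ_antipodeQ_MQ:
  assumes I: "I \<in> vcomps"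
  shows "zetakQ k (antipodeQ (MQ I)) = (- 1) ^ length I * ksign k (sum_list I)"
proof -
  note w = word_series_decreasing_in_QSym_deg[OF I]
  have "zetaQ (antipode_MQ I) = (- 1) ^ length I"
    using w QSym_deg_subset
    by (subst antipode_MQ_def, subst zetaQ_linear) (auto simp: zetaQ_word_series_decreasing[OF I])
  moreover have "antipode_MQ I \<in> QSym_deg (sum_list I)"
    unfolding antipode_MQ_def using w by (rule ps.span_scale)
  ultimately show ?thesis by (simp add: antipodeQ_MQ I zetakQ_QSym_deg)
qed

section \<open>Values of nu on monomial functions\<close>

lemma nuQ_MQ_Nil: "nuQ k (MQ []) = 1"
proof -
  have "ksign k 0 = 1" by (simp add: ksign_def vabs_def)
  then show ?thesis
    by (simp add: nuQ_def convQ_MQ[OF vector_space_rat] zetakQ_antipodeQ_MQ zetaQ_MQ)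
qed

text \<open>Zeta kills every suffix with more than one column, so only the cuts just before and just
  after \<open>i\<close> survive.\<close>

lemma nuQ_MQ_snoc:
  assumes I: "E @ [i] \<in> vcomps"
  shows "nuQ k (MQ (E @ [i])) =
    (- 1) ^ length E * (ksign k (sum_list E) - ksign k (sum_list E + i))"
proof -
  let ?I = "E @ [i]"
  let ?t = "\<lambda>p. zetakQ k (antipodeQ (MQ (take p ?I))) * zetaQ (MQ (drop p ?I))"
  have "nuQ k (MQ ?I) = (\<Sum>p\<le>length ?I. ?t p)"
    unfolding nuQ_def using I by (simp only: convQ_MQ[OF vector_space_rat] comp_def)
  also have "\<dots> = (\<Sum>p\<in>{length E, Suc (length E)}. ?t p)"
    using I by (intro sum.mono_neutral_right) (auto simp: zetaQ_MQ not_less_eq_eq)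
  also have "\<dots> = ?t (length E) + ?t (length ?I)" by simp
  also have "\<dots> = (- 1) ^ length E * (ksign k (sum_list E) - ksign k (sum_list E + i))"
    using I by (simp add: zetakQ_antipodeQ_MQ zetaQ_MQ algebra_simps)
  finally show ?thesis .
qed

lemma vabs_add: "vabs (m + n) = vabs m + vabs n"
  by (simp add: vabs_def sum.distrib)

lemma vle_add:
  assumes "m + n \<le>\<^sub>v k"
  shows "m \<le>\<^sub>v k"
proof -
  have "enat (m $ i) \<le> k $ i" for i
  proof -
    have "enat (m $ i) \<le> enat ((m + n) $ i)" by simp
    also have "\<dots> \<le> k $ i" using assms unfolding vle_def less_eq_vec_def by simp
    finally show ?thesis .
  qed
  then show ?thesis by (simp add: vle_def less_eq_vec_def)
qed

text \<open>Both value formulas have this shape, with \<open>i\<close> the last column for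
  \<open>MQ\<close> and its leading coordinate vector for \<open>FQ\<close>. Since
  \<open>m + i \<le>\<^sub>v k\<close> forces \<open>m \<le>\<^sub>v k\<close>, three cases
  remain.\<close>

lemma ksign_diff:
  "(- 1) ^ c * (ksign k m - ksign k (m + i)) =
     (if odd (vabs i) \<and> m + i \<le>\<^sub>v k then 2 * (- 1) ^ (Suc c + vabs (m + i))
      else if odd (vabs m) \<and> m \<le>\<^sub>v k \<and> \<not> m + i \<le>\<^sub>v k then 2 * (- 1) ^ Suc c else 0)"
  using vle_add[of m i k]
  by (cases "m \<le>\<^sub>v k"; cases "m + i \<le>\<^sub>v k"; cases "even (vabs m)"; cases "even (vabs i)"; cases "even c")
    (simp_all add: ksign_def vabs_add minus_one_power_iff)


section \<open>Refinements and fundamental functions\<close>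

definition supp_le :: "nat ^ 'l::{finite,linorder} \<Rightarrow> nat ^ 'l::{finite,linorder} \<Rightarrow> bool" where
  "supp_le u v \<longleftrightarrow> (\<forall>a\<in>vsupp u. \<forall>b\<in>vsupp v. a \<le> b)"

definition refinements :: "nat ^ 'l::{finite,linorder} \<Rightarrow> 'l vcomp set" where
  "refinements i = {K \<in> vcomps. sum_list K = i \<and> sorted_wrt supp_le K}"

lemma vrefines_Nil: "[] \<preceq>\<^sub>v J \<longleftrightarrow> J = []"
  by (simp add: vrefines_def)

text \<open>Peeling off the block of the first column gives a recursive form suited to induction on
  \<open>I\<close>.\<close>

lemma vrefines_Cons: "i # I \<preceq>\<^sub>v J \<longleftrightarrow> (\<exists>K J'. K \<in> refinements i \<and> I \<preceq>\<^sub>v J' \<and> J = K @ J')"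
  (is "?L \<longleftrightarrow> ?R")
proof
  assume ?L
  then obtain Js where Js: "J = concat Js"
    "list_all2 (\<lambda>i K. K \<in> vcomps \<and> sum_list K = i \<and>
       sorted_wrt (\<lambda>u v. \<forall>a\<in>vsupp u. \<forall>b\<in>vsupp v. a \<le> b) K) (i # I) Js"
    unfolding vrefines_def by blast
  then obtain K Js' where "Js = K # Js'" "K \<in> refinements i"
    "list_all2 (\<lambda>i K. K \<in> vcomps \<and> sum_list K = i \<and>
       sorted_wrt (\<lambda>u v. \<forall>a\<in>vsupp u. \<forall>b\<in>vsupp v. a \<le> b) K) I Js'"
    by (auto simp: list_all2_Cons1 refinements_def supp_le_def[abs_def])
  with Js show ?R
    unfolding vrefines_def by (intro exI[of _ K] exI[of _ "concat Js'"]) auto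
next
  assume ?R
  then obtain K Js' where "K \<in> refinements i" "J = K @ concat Js'"
    "list_all2 (\<lambda>i K. K \<in> vcomps \<and> sum_list K = i \<and>
       sorted_wrt (\<lambda>u v. \<forall>a\<in>vsupp u. \<forall>b\<in>vsupp v. a \<le> b) K) I Js'"
    unfolding vrefines_def by blast
  then show ?L
    unfolding vrefines_def by (intro exI[of _ "K # Js'"]) (auto simp: refinements_def supp_le_def[abs_def])
qed

lemma vrefines_single: "[i] \<preceq>\<^sub>v J \<longleftrightarrow> J \<in> refinements i"
  by (simp add: vrefines_Cons vrefines_Nil)

lemma vrefines_vcomp:
  assumes "I \<preceq>\<^sub>v J"
  shows "J \<in> vcomps \<and> sum_list J = sum_list I"
  using assms
  by (induction I arbitrary: J) (auto simp: vrefines_Nil vrefines_Cons refinements_def)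

section \<open>Refinements of a single column\<close>

lemma vabs_eq_0_iff: "vabs n = 0 \<longleftrightarrow> n = 0"
  by (simp add: vabs_def vec_eq_iff)

lemma vabs_axis [simp]: "vabs (axis j c) = c"
  by (simp add: vabs_def axis_def)

lemma length_le_vabs: "K \<in> vcomps \<Longrightarrow> length K \<le> vabs (sum_list K)"
proof (induction K)
  case (Cons a K)
  then have "vabs a \<noteq> 0" by (simp add: vabs_eq_0_iff)
  with Cons show ?case by (auto simp: vabs_add)
qed simp

lemma member_le_sum_list_vec: "v \<in> set K \<Longrightarrow> v $ j \<le> sum_list K $ j" for v :: "nat ^ 'l::finite"
  by (induction K) auto

text \<open>The columns are bounded coordinatewise by \<open>i\<close>, and the length by
  \<open>vabs i\<close> since every column contributes at least 1.\<close>

lemma finite_refinements: "finite (refinements i)"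
proof (rule finite_subset)
  let ?V = "vec_lambda ` (PiE UNIV (\<lambda>j. {..i $ j}))"
  show "refinements i \<subseteq> {K. set K \<subseteq> ?V \<and> length K \<le> vabs i}"
  proof safe
    fix K v assume K: "K \<in> refinements i" "v \<in> set K"
    then have "v $ j \<le> i $ j" for j
      using member_le_sum_list_vec[of v K j] by (auto simp: refinements_def)
    then show "v \<in> ?V"
      by (intro image_eqI[where x = "vec_nth v"]) (auto simp: vec_nth_inverse)
  qed (auto simp: refinements_def length_le_vabs)
  show "finite {K. set K \<subseteq> ?V \<and> length K \<le> vabs i}"
    by (intro finite_lists_length_le finite_imageI finite_PiE) auto
qed

text \<open>An explicit form of \<open>head_coord\<close>, with which it agrees for
  \<open>vabs i > 1\<close>. It also covers coordinate vectors, where it returns \<open>i\<close>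
  itself.\<close>

definition lead_axis :: "nat ^ 'l::{finite,linorder} \<Rightarrow> nat ^ 'l::{finite,linorder}" where
  "lead_axis i = axis (Min (vsupp i)) 1"

lemma vsupp_simps:
  "vsupp (u + v) = vsupp u \<union> vsupp v" "c \<noteq> 0 \<Longrightarrow> vsupp (axis j c) = {j}"
  "vsupp u = {} \<longleftrightarrow> u = 0"
  by (auto simp: vsupp_def axis_def vec_eq_iff)

lemma vsupp_diff: "vsupp (u - v) \<subseteq> vsupp u"
  by (auto simp: vsupp_def)

lemma axis_add_diff: "j \<in> vsupp u \<Longrightarrow> axis j 1 + (u - axis j 1) = u"
  by (auto simp: vsupp_def vec_eq_iff axis_def)

lemma lead_axis_add_diff: "Min (vsupp i) \<in> vsupp u \<Longrightarrow> lead_axis i + (u - lead_axis i) = u"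
  unfolding lead_axis_def by (rule axis_add_diff)

lemma vabs_lead_axis [simp]: "vabs (lead_axis i) = 1"
  by (simp add: lead_axis_def)

lemma vec_add_diff_cancel: "u + v - u = v" for u v :: "nat ^ 'l::finite"
  by (simp add: vec_eq_iff)

lemma Min_vsupp:
  assumes "i \<noteq> 0"
  shows "Min (vsupp i) \<in> vsupp i" "b \<in> vsupp i \<Longrightarrow> Min (vsupp i) \<le> b"
  using assms by (auto intro!: Min_in simp: vsupp_simps(3))

lemma vsupp_sum_list: "vsupp (sum_list K) = (\<Union>v\<in>set K. vsupp v)"
proof (induction K)
  case Nil
  show ?case by (simp add: vsupp_def)
qed (simp add: vsupp_simps)

text \<open>If the least index lies in a later column, sortedness bounds every index of the nonzero
  first column by it, and minimality turns this bound into equality.\<close>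

lemma lead_index_in_first_column:
  assumes "k # K \<in> refinements i"
  shows "Min (vsupp i) \<in> vsupp k"
proof -
  from assms have k: "k \<noteq> 0" and i: "i = sum_list (k # K)" and s: "\<And>v. v \<in> set K \<Longrightarrow> supp_le k v"
    by (auto simp: refinements_def)
  have "i \<noteq> 0" using k i by (auto simp: vec_eq_iff)
  note m = Min_vsupp[OF this]
  obtain v where v: "v \<in> set (k # K)" "Min (vsupp i) \<in> vsupp v"
    using m(1) vsupp_sum_list[of "k # K"] i by auto
  obtain a where a: "a \<in> vsupp k" using k vsupp_simps(3) by blast
  then have "Min (vsupp i) \<le> a"
    by (intro m) (simp add: i vsupp_simps)
  with v a s show ?thesis by (force simp: supp_le_def)
qed

text \<open>Merging a first column equal to the leading coordinate vector into the second one, or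
  splitting it off the first column otherwise, is a sign-reversing involution. It preserves the last
  column, except that it pairs \<open>[i]\<close> with \<open>[e, i - e]\<close>.\<close>

lemma sum_refinements_large:
  fixes h :: "nat ^ 'l::{finite,linorder} \<Rightarrow> rat"
  assumes i: "vabs i > 1"
  shows "(\<Sum>K\<in>refinements i. (- 1) ^ length K * h (last K)) = h (i - lead_axis i) - h i"
proof -
  define e where "e = lead_axis i"
  let ?A = "{K \<in> refinements i. hd K \<noteq> e}" and ?B = "{K \<in> refinements i. hd K = e}"
  let ?f = "\<lambda>K. e # (hd K - e) # tl K"
  let ?t = "\<lambda>K. (- 1) ^ length K * h (last K)"
  have v: "vabs e = 1" by (simp add: e_def)
  have i0: "i \<noteq> 0" and e0: "e \<noteq> 0"
    using i v vabs_eq_0_iff[of i] vabs_eq_0_iff[of e] by auto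
  have ie: "i \<noteq> e" using i v by auto
  note m = Min_vsupp[OF i0]
  have ne: "K \<noteq> []" if "K \<in> refinements i" for K
    using that i0 by (auto simp: refinements_def)
  \<comment> \<open>The index of \<open>e\<close> is least in the support of \<open>i\<close>, so
    \<open>e\<close> may precede any column supported there.\<close>
  have se: "supp_le e v" if "vsupp v \<subseteq> vsupp i" for v
    using that m(2) by (auto simp: supp_le_def e_def lead_axis_def vsupp_simps)
  have bij: "bij_betw ?f ?A ?B"
  proof (rule bij_betw_byWitness[where f' = "\<lambda>K. (e + hd (tl K)) # tl (tl K)"])
    have split: "e + (k - e) = k" if "k # K \<in> refinements i" for k K
      using lead_index_in_first_column[OF that] by (simp add: e_def lead_axis_add_diff)
    \<comment> \<open>Since \<open>i\<close> differs from \<open>e\<close>, a refinement starting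
      with \<open>e\<close> has a second column to merge with.\<close>
    have B: "\<exists>k K'. K = e # k # K'" if K: "K \<in> ?B" for K
    proof (cases K)
      case Nil
      then show ?thesis using K ne by auto
    next
      case (Cons k K')
      then show ?thesis using K ie by (cases K') (auto simp: refinements_def)
    qed
    show "\<forall>K\<in>?A. (\<lambda>K. (e + hd (tl K)) # tl (tl K)) (?f K) = K"
    proof
      fix K assume "K \<in> ?A"
      then show "(\<lambda>K. (e + hd (tl K)) # tl (tl K)) (?f K) = K"
        using ne split by (cases K) auto
    qed
    show "\<forall>K\<in>?B. ?f ((\<lambda>K. (e + hd (tl K)) # tl (tl K)) K) = K"
    proof
      fix K assume "K \<in> ?B"
      then show "?f ((\<lambda>K. (e + hd (tl K)) # tl (tl K)) K) = K"
        using B[of K] by (auto simp: vec_add_diff_cancel)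
    qed
    show "?f ` ?A \<subseteq> ?B"
    proof (rule image_subsetI)
      fix K assume K: "K \<in> ?A"
      then obtain k K' where kK: "K = k # K'" using ne by (cases K) auto
      with K have r: "k # K' \<in> refinements i" and k: "k \<noteq> e" by auto
      have s: "vsupp v \<subseteq> vsupp i" if "v \<in> set (k # K')" for v
        using r that vsupp_sum_list[of "k # K'"] by (auto simp: refinements_def simp del: sum_list.Cons)
      have "supp_le (k - e) v" if "v \<in> set K'" for v
        using r that vsupp_diff[of k e] by (auto simp: refinements_def supp_le_def)
      moreover have "supp_le e v" if "v \<in> insert (k - e) (set K')" for v
        using that s vsupp_diff[of k e] by (intro se) auto
      moreover have "k - e \<noteq> 0" using k split[OF r] by auto
      moreover have "e + ((k - e) + sum_list K') = i"
        using split[OF r] r by (simp add: refinements_def flip: add.assoc)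
      ultimately show "?f K \<in> ?B"
        using r e0 by (simp add: kK refinements_def)
    qed
    show "(\<lambda>K. (e + hd (tl K)) # tl (tl K)) ` ?B \<subseteq> ?A"
    proof (rule image_subsetI)
      fix K assume K: "K \<in> ?B"
      then obtain k K' where kK: "K = e # k # K'" using B by blast
      with K have r: "e # k # K' \<in> refinements i" by auto
      have "supp_le (e + k) v" if "v \<in> set K'" for v
        using r that by (auto simp: refinements_def supp_le_def vsupp_simps)
      \<comment> \<open>The merged column differs from \<open>e\<close> because \<open>k\<close> is
        nonzero, so the result falls into \<open>?A\<close>.\<close>
      moreover have "e + k \<noteq> 0" "e + k \<noteq> e" using r by (auto simp: refinements_def vec_eq_iff)
      ultimately show "(e + hd (tl K)) # tl (tl K) \<in> ?A"
        using r by (simp add: kK refinements_def add.assoc)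
    qed
  qed
  have fin: "finite ?A" "finite ?B" using finite_refinements[of i] by auto
  have single: "[i] \<in> ?A" using i0 ie by (simp add: refinements_def)
  have "refinements i = ?A \<union> ?B" by auto
  then have "(\<Sum>K\<in>refinements i. ?t K) = (\<Sum>K\<in>?A \<union> ?B. ?t K)" by simp
  also have "\<dots> = (\<Sum>K\<in>?A. ?t K) + (\<Sum>K\<in>?B. ?t K)"
    using fin by (intro sum.union_disjoint) auto
  also have "(\<Sum>K\<in>?B. ?t K) = (\<Sum>K\<in>?A. ?t (?f K))"
    by (rule sum.reindex_bij_betw[OF bij, symmetric])
  also have "(\<Sum>K\<in>?A. ?t K) + \<dots> = (\<Sum>K\<in>?A. ?t K + ?t (?f K))"
    by (rule sum.distrib[symmetric])
  also have "\<dots> = (\<Sum>K\<in>{[i]}. ?t K + ?t (?f K))"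
  proof (rule sum.mono_neutral_right[OF fin(1)])
    show "\<forall>K\<in>?A - {[i]}. ?t K + ?t (?f K) = 0"
    proof
      fix K assume K: "K \<in> ?A - {[i]}"
      then obtain k K' where kK: "K = k # K'" using ne by (cases K) auto
      with K have "K' \<noteq> []" by (auto simp: refinements_def)
      then show "?t K + ?t (?f K) = 0" by (simp add: kK)
    qed
  qed (use single in auto)
  also have "\<dots> = h (i - e) - h i" by simp
  finally show ?thesis by (simp add: e_def)
qed

text \<open>A column of size 1 is refined only by itself, so only the term of \<open>[i]\<close>
  remains in that case.\<close>

lemma sum_refinements:
  fixes h :: "nat ^ 'l::{finite,linorder} \<Rightarrow> rat"
  assumes i: "i \<noteq> 0"
  shows "(\<Sum>K\<in>refinements i. (- 1) ^ length K * h (last K)) =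
    (if vabs i > 1 then h (i - lead_axis i) else 0) - h i"
proof (cases "vabs i > 1")
  case True
  then show ?thesis by (simp add: sum_refinements_large)
next
  case False
  have "K = [i]" if K: "K \<in> refinements i" for K
  proof -
    have "length K \<le> 1" using K length_le_vabs[of K] False by (auto simp: refinements_def)
    then show ?thesis using K i by (cases K) (auto simp: refinements_def)
  qed
  moreover have "[i] \<in> refinements i" using i by (simp add: refinements_def)
  ultimately have "refinements i = {[i]}" by blast
  then show ?thesis using False by simp
qed

section \<open>Coordinate vectors and refinements of whole compositions\<close>

lemma coord_vectors_iff: "n \<in> coord_vectors \<longleftrightarrow> vabs n = 1"
proof
  assume *: "vabs n = 1"
  then have "n \<noteq> 0" by (auto simp: vabs_def)
  then obtain j where j: "n $ j \<noteq> 0" by (auto simp: vec_eq_iff)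
  then have s: "axis j 1 + (n - axis j 1) = n"
    by (intro axis_add_diff) (simp add: vsupp_def)
  have "n - axis j 1 = 0"
    using * arg_cong[OF s, of vabs] by (simp add: vabs_add vabs_eq_0_iff)
  then have "n = axis j 1" using s by simp
  then show "n \<in> coord_vectors" by (auto simp: coord_vectors_def)
qed (auto simp: coord_vectors_def)

lemma lead_axis_eq: "vabs i = 1 \<Longrightarrow> lead_axis i = i"
  unfolding coord_vectors_iff[symmetric]
  by (auto simp: coord_vectors_def lead_axis_def vsupp_simps)

text \<open>Partial sums grow at every nonzero column, so a prefix is determined by its sum. Hence a
  refinement determines its blocks.\<close>

lemma append_sum_list_cancel:
  assumes "K \<in> vcomps" "L \<in> vcomps" "sum_list K = sum_list L" "K @ J = L @ J'"
  shows "K = L \<and> J = J'"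
  using assms
proof (induction K arbitrary: L)
  case Nil
  then show ?case using sum_list_vcomp_eq_0[of L] by auto
next
  case (Cons a K)
  then have "L \<noteq> []" using sum_list_vcomp_eq_0[of "a # K"] by auto
  then show ?case using Cons.IH[of "tl L"] Cons.prems by (cases L) auto
qed

lemma vrefines_Cons_bij:
  "bij_betw (\<lambda>(K, J). K @ J) (refinements i \<times> {J. I \<preceq>\<^sub>v J}) {J. i # I \<preceq>\<^sub>v J}"
  unfolding bij_betw_def
proof
  show "inj_on (\<lambda>(K, J). K @ J) (refinements i \<times> {J. I \<preceq>\<^sub>v J})"
  proof (rule inj_onI, clarify)
    fix K J L J' assume "K \<in> refinements i" "L \<in> refinements i" "K @ J = L @ J'"
    then show "K = L \<and> J = J'"
      by (intro append_sum_list_cancel) (auto simp: refinements_def)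
  qed
  show "(\<lambda>(K, J). K @ J) ` (refinements i \<times> {J. I \<preceq>\<^sub>v J}) = {J. i # I \<preceq>\<^sub>v J}"
    by (force simp: vrefines_Cons)
qed

text \<open>The weight is a sign for the total length times a function of the last column, so the
  sum factors over the blocks and \<open>h\<close> is seen only by the last one.\<close>

lemma sum_vrefines:
  fixes h :: "nat ^ 'l::{finite,linorder} \<Rightarrow> rat"
  assumes "E @ [i] \<in> vcomps"
  shows "(\<Sum>J | E @ [i] \<preceq>\<^sub>v J. (- 1) ^ length J * h (last J)) =
    (if set E \<subseteq> coord_vectors then (- 1) ^ length E else 0) *
    (\<Sum>K\<in>refinements i. (- 1) ^ length K * h (last K))"
  using assms
proof (induction E)
  case Nil
  then show ?case by (simp add: vrefines_single)
next
  case (Cons a E)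
  let ?t = "\<lambda>K. (- 1) ^ length K * h (last K)"
  have a: "a \<noteq> 0" using Cons.prems by simp
  \<comment> \<open>A nonempty remainder ensures that \<open>last (K @ J)\<close> is
    \<open>last J\<close>.\<close>
  have ne: "J \<noteq> []" if "E @ [i] \<preceq>\<^sub>v J" for J
    using vrefines_vcomp[OF that] Cons.prems sum_list_vcomp_eq_0[of "E @ [i]"] by auto
  \<comment> \<open>With constant weight 1 the two terms of \<open>sum_refinements\<close> cancel
    unless the column has size 1.\<close>
  have c: "(\<Sum>K\<in>refinements a. (- 1) ^ length K) = (if a \<in> coord_vectors then - 1 else 0 :: rat)"
  proof -
    have "vabs a \<noteq> 0" using a by (simp add: vabs_eq_0_iff)
    then show ?thesis
      using sum_refinements[OF a, of "\<lambda>_. 1"] by (auto simp: coord_vectors_iff)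
  qed
  have "(\<Sum>J | (a # E) @ [i] \<preceq>\<^sub>v J. ?t J) =
      (\<Sum>(K, J)\<in>refinements a \<times> {J. E @ [i] \<preceq>\<^sub>v J}. ?t (K @ J))"
    using sum.reindex_bij_betw[OF vrefines_Cons_bij[of a "E @ [i]"], of ?t]
    by (simp add: case_prod_unfold)
  also have "\<dots> = (\<Sum>(K, J)\<in>refinements a \<times> {J. E @ [i] \<preceq>\<^sub>v J}. (- 1) ^ length K * ?t J)"
    by (intro sum.cong) (auto simp: ne power_add)
  also have "\<dots> = (\<Sum>K\<in>refinements a. (- 1) ^ length K) * (\<Sum>J | E @ [i] \<preceq>\<^sub>v J. ?t J)"
    by (simp add: sum_product sum.cartesian_product)
  finally show ?case using Cons by (auto simp: c)
qed

text \<open>All refinements \<open>J\<close> share the sum \<open>s\<close>, so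
  \<open>nuQ k (MQ J)\<close> depends only on the length and the last column of \<open>J\<close>,
  the form that \<open>sum_vrefines\<close> handles.\<close>

lemma nuQ_FQ:
  assumes I: "E @ [i] \<in> vcomps"
  shows "nuQ k (FQ (E @ [i])) =
    (if set E \<subseteq> coord_vectors then (- 1) ^ length E else 0) *
    (ksign k (sum_list E) - ksign k (sum_list E + lead_axis i))"
proof -
  define s where "s = sum_list E + i"
  \<comment> \<open>The order of the difference is reversed because the sign in
    \<open>nuQ_MQ_snoc\<close> omits the last column.\<close>
  define h where "h l = ksign k s - ksign k (s - l)" for l
  have i: "i \<noteq> 0" using I by simp
  have "nuQ k (FQ (E @ [i])) = (\<Sum>J | E @ [i] \<preceq>\<^sub>v J. nuQ k (MQ J))"
    unfolding nuQ_def FQ_def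
    by (intro convQ_sum[OF vector_space_rat]) (auto dest: vrefines_vcomp)
  also have "\<dots> = (\<Sum>J | E @ [i] \<preceq>\<^sub>v J. (- 1) ^ length J * h (last J))"
  proof (rule sum.cong)
    fix J assume "J \<in> {J. E @ [i] \<preceq>\<^sub>v J}"
    then have J: "J \<in> vcomps" "sum_list J = s" by (auto simp: s_def dest: vrefines_vcomp)
    have "s \<noteq> 0" using i by (auto simp: s_def vec_eq_iff)
    with J obtain F j where Fj: "J = F @ [j]" by (cases J rule: rev_cases) auto
    have s: "s = sum_list F + j" using J Fj by simp
    have "s - j = sum_list F" by (simp add: s vec_eq_iff)
    moreover have "nuQ k (MQ J) = (- 1) ^ length F * (ksign k (sum_list F) - ksign k s)"
      using nuQ_MQ_snoc[of F j k] J(1) by (simp add: Fj s)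
    ultimately show "nuQ k (MQ J) = (- 1) ^ length J * h (last J)"
      by (simp add: Fj h_def algebra_simps)
  qed simp
  also have "\<dots> = (if set E \<subseteq> coord_vectors then (- 1) ^ length E else 0) *
    (\<Sum>K\<in>refinements i. (- 1) ^ length K * h (last K))"
    by (rule sum_vrefines[OF I])
  also have "(\<Sum>K\<in>refinements i. (- 1) ^ length K * h (last K)) =
      ksign k (sum_list E) - ksign k (sum_list E + lead_axis i)"
  proof -
    have h: "h i = ksign k s - ksign k (sum_list E)"
      by (simp add: h_def s_def vec_eq_iff)
    have l: "lead_axis i + (i - lead_axis i) = i"
      by (rule lead_axis_add_diff) (rule Min_vsupp[OF i])
    have "s - (i - lead_axis i) = sum_list E + lead_axis i"
      unfolding s_def by (subst (1) l[symmetric]) (simp add: vec_eq_iff)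
    then have "h (i - lead_axis i) = ksign k s - ksign k (sum_list E + lead_axis i)"
      by (simp add: h_def)
    \<comment> \<open>For size 1 the block sum is just \<open>- h i\<close>, which matches the
      formula because the leading vector is \<open>i\<close>.\<close>
    moreover have "lead_axis i = i" if "\<not> vabs i > 1"
      using that i vabs_eq_0_iff[of i] by (intro lead_axis_eq) linarith
    ultimately show ?thesis by (auto simp: sum_refinements[OF i] h s_def)
  qed
  finally show ?thesis .
qed

text \<open>The first column must contain the least index of \<open>i\<close>, and a coordinate
  vector has only one. Conversely, \<open>vabs i > 1\<close> keeps \<open>i - e\<close>
  nonzero.\<close>

lemma lead_axis_unique:
  assumes i: "vabs i > 1"
  shows "e \<in> coord_vectors \<and> [i] \<preceq>\<^sub>v [e, i - e] \<longleftrightarrow> e = lead_axis i"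
proof
  assume e: "e \<in> coord_vectors \<and> [i] \<preceq>\<^sub>v [e, i - e]"
  then obtain j where j: "e = axis j 1" by (auto simp: coord_vectors_def)
  have "Min (vsupp i) \<in> vsupp e"
    using e by (intro lead_index_in_first_column[of e "[i - e]"]) (simp add: vrefines_single)
  then show "e = lead_axis i" by (simp add: j lead_axis_def vsupp_simps)
next
  have i0: "i \<noteq> 0" using i by (auto simp: vabs_def)
  note m = Min_vsupp[OF i0]
  assume e: "e = lead_axis i"
  then have s: "e + (i - e) = i"
    using m(1) by (simp add: lead_axis_add_diff)
  have v: "vabs e = 1" by (simp add: e)
  have "e \<noteq> 0" using v by (auto simp: vabs_def)
  moreover have "i - e \<noteq> 0" using s i v by auto
  moreover have "supp_le e (i - e)"
    using m(2) vsupp_diff[of i e] by (auto simp: supp_le_def e lead_axis_def vsupp_simps)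
  ultimately show "e \<in> coord_vectors \<and> [i] \<preceq>\<^sub>v [e, i - e]"
    using s v by (simp add: coord_vectors_iff vrefines_single refinements_def)
qed

lemma head_coord_eq: "vabs i > 1 \<Longrightarrow> head_coord i = lead_axis i"
  by (simp add: head_coord_def lead_axis_unique)

lemma vabs_sum_list_coord_vectors: "set E \<subseteq> coord_vectors \<Longrightarrow> vabs (sum_list E) = length E"
proof (induction E)
  case Nil
  show ?case by (simp add: vabs_eq_0_iff)
qed (simp add: vabs_add coord_vectors_iff)

text \<open>With \<open>e\<close> the leading vector, the three alternatives together say that
  \<open>sum_list E + e\<close> is below \<open>k\<close>, or that \<open>E\<close> has odd size and
  its sum is below \<open>k\<close>. When \<open>i\<close> is a coordinate vector,
  \<open>e = i\<close> and the first alternative takes over from the third.\<close>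

lemma nuQ_FQ_snoc:
  assumes I: "E @ [i] \<in> vcomps"
  shows "nuQ k (FQ (E @ [i])) =
    (if set E \<subseteq> coord_vectors \<and>
        (sum_list E + i \<le>\<^sub>v k
         \<or> odd (vabs (sum_list E)) \<and> sum_list E \<le>\<^sub>v k
         \<or> even (vabs (sum_list E)) \<and> vabs i > 1 \<and> sum_list E + head_coord i \<le>\<^sub>v k)
     then 2 else 0)"
proof (cases "set E \<subseteq> coord_vectors")
  case True
  let ?e = "lead_axis i"
  have i: "i \<noteq> 0" using I by simp
  have "sum_list E + ?e \<le>\<^sub>v k" if "sum_list E + i \<le>\<^sub>v k"
  proof (rule vle_add)
    have "?e + (i - ?e) = i"
      by (rule lead_axis_add_diff) (rule Min_vsupp[OF i])
    then show "sum_list E + ?e + (i - ?e) \<le>\<^sub>v k" using that by (simp add: add.assoc)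
  qed
  moreover have "?e = i" if "\<not> vabs i > 1"
    using that i vabs_eq_0_iff[of i] by (intro lead_axis_eq) linarith
  moreover have "head_coord i = ?e" if "vabs i > 1" using that by (rule head_coord_eq)
  moreover have "sum_list E \<le>\<^sub>v k" if "sum_list E + ?e \<le>\<^sub>v k" using that by (rule vle_add)
  \<comment> \<open>Since \<open>E\<close> consists of coordinate vectors, its length equals the
    size of its sum, so all signs cancel to 2.\<close>
  moreover have "nuQ k (FQ (E @ [i])) =
      (if sum_list E + ?e \<le>\<^sub>v k then 2
       else if odd (vabs (sum_list E)) \<and> sum_list E \<le>\<^sub>v k then 2 else 0)"
  proof -
    have "nuQ k (FQ (E @ [i])) =
        (- 1) ^ length E * (ksign k (sum_list E) - ksign k (sum_list E + ?e))"
      using True by (simp only: nuQ_FQ[OF I] if_True)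
    then show ?thesis
      unfolding ksign_diff using True
      by (simp add: vabs_add vabs_sum_list_coord_vectors minus_one_power_iff)
  qed
  ultimately show ?thesis using True by (cases "vabs i > 1") auto
next
  case False
  then show ?thesis by (simp add: nuQ_FQ[OF I])
qed

theorem theorem6p2:
  fixes k :: "enat ^ 'l::{finite,linorder}"
    and I :: "'l vcomp"
  assumes "I \<in> vcomps"
  shows "nuQ k (MQ I) =
          (if I = [] then 1
           else if odd (vabs (last I)) \<and> sum_list I \<le>\<^sub>v k
             then 2 * (-1) ^ (length I + vabs (sum_list I))
           else if odd (vabs (sum_list I) - vabs (last I)) \<and>
                   (sum_list I - last I) \<le>\<^sub>v k \<and> \<not> sum_list I \<le>\<^sub>v k
             then 2 * (-1) ^ length I
           else 0)
       \<and> nuQ k (FQ I) =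
          (if I = [] then 1
           else if \<exists>E i. I = E @ [i] \<and> set E \<subseteq> coord_vectors \<and>
                  (sum_list I \<le>\<^sub>v k
                   \<or> odd (vabs (sum_list E)) \<and> sum_list E \<le>\<^sub>v k
                   \<or> even (vabs (sum_list E)) \<and> vabs i > 1 \<and>
                      (sum_list E + head_coord i) \<le>\<^sub>v k)
             then 2
           else 0)
       \<and> (\<forall>i :: nat ^ 'l::{finite,linorder}. vabs i > 1 \<longrightarrow>
             (\<exists>!e. e \<in> coord_vectors \<and> [i] \<preceq>\<^sub>v [e, i - e]) \<and>
             head_coord i = axis (Min (vsupp i)) 1)"
proof -
  have "\<forall>i :: nat ^ 'l::{finite,linorder}. vabs i > 1 \<longrightarrow>
             (\<exists>!e. e \<in> coord_vectors \<and> [i] \<preceq>\<^sub>v [e, i - e]) \<and>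
             head_coord i = axis (Min (vsupp i)) 1"
    by (simp add: lead_axis_unique head_coord_eq lead_axis_def)
  moreover have "nuQ k (FQ []) = 1"
    by (simp add: FQ_def vrefines_Nil nuQ_MQ_Nil)
  \<comment> \<open>Coordinatewise subtraction is truncated, but it recovers the prefix sum from the
    total.\<close>
  moreover have "sum_list E + i - i = sum_list E" for E :: "'l vcomp" and i
    by (simp add: vec_eq_iff)
  ultimately show ?thesis
    using assms
    by (cases I rule: rev_cases)
      (simp_all add: nuQ_MQ_Nil nuQ_MQ_snoc nuQ_FQ_snoc ksign_diff vabs_add)
qed

end
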